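(* Let $u$ be a plurisubharmonic function near the origin $o\in\mathbb{C}^n$. Let $I,J\subseteq\mathcal{O}_{o}$ be coherent ideals with $J\ne 0$ and $c_o^I(u)<+\infty$, such that $IJ\subseteq\mathcal{I}(c^{I}_{o}(u)u)_{o}$ (equivalently, $c^{IJ}_{o}(u)>c^{I}_{o}(u)$). Then $$\frac{c^{I}_{o}(u)}{c^{IJ}_{o}(u)-c^{I}_{o}(u)}\ge c_{o}^{I}(\log|J|).$$
   Context: $\mathcal{O}_o$ is the ring of germs of holomorphic functions at $o$. Plurisubharmonic functions are not identically $-\infty$. The multiplier ideal sheaf $\mathcal{I}(u)$ is the sheaf of germs of holomorphic functions $f$ such that $|f|^2e^{-2u}$ is locally integrable. For an ideal $I\subseteq\mathcal{O}_o$ (always finitely generated) with generators $f_1,\dots,f_s$, $|I|=\sum_j|f_j|$ (the choice of generators is irrelevant for the quantities below). The jumping number is $c_o^I(u)=\sup\{c\ge0:\ |I|^2e^{-2cu}\text{ is integrable near }o\}=\sup\{c\ge0:\ \mathcal{I}(cu)_o\supseteq I\}\in[0,+\infty]$. $IJ$ is the product ideal. *)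

theory Defs
  imports "HOL-Analysis.Analysis" "HOL-Algebra.Ideal_Product" "HOL-Algebra.Algebraic_Closure_Type"
begin

section \<open>Germs of holomorphic functions at the origin of \<open>\<complex>\<^sup>n\<close>\<close>

text \<open>The space \<open>\<complex>\<^sup>n\<close> is \<^typ>\<open>complex^'n\<close>. A function of several variables is holomorphic if at
  each point it is real differentiable with a complex linear derivative.\<close>

definition holo_on :: "(complex^'n \<Rightarrow> complex) \<Rightarrow> (complex^'n) set \<Rightarrow> bool" where
  "holo_on f U \<longleftrightarrow> open U \<and>
     (\<forall>z\<in>U. \<exists>D. (f has_derivative D) (at z) \<and> (\<forall>c v. D (c *s v) = c * D v))"

definition holo_near0 :: "(complex^'n \<Rightarrow> complex) \<Rightarrow> bool" where
  "holo_near0 f \<longleftrightarrow> (\<exists>U. 0 \<in> U \<and> holo_on f U)"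

definition germ_eq :: "(complex^'n \<Rightarrow> complex) \<Rightarrow> (complex^'n \<Rightarrow> complex) \<Rightarrow> bool" where
  "germ_eq f g \<longleftrightarrow> holo_near0 f \<and> holo_near0 g \<and> (\<forall>\<^sub>F z in nhds 0. f z = g z)"

lemma holo_on_const: "open U \<Longrightarrow> holo_on (\<lambda>_. c) U"
  by (auto simp: holo_on_def intro!: exI[of _ "\<lambda>_. 0"])

lemma holo_on_subset: "holo_on f U \<Longrightarrow> open V \<Longrightarrow> V \<subseteq> U \<Longrightarrow> holo_on f V"
  by (auto simp: holo_on_def)

lemma holo_on_add:
  assumes "holo_on f U" "holo_on g U" shows "holo_on (\<lambda>z. f z + g z) U"
  unfolding holo_on_def
proof (intro conjI ballI)
  show "open U" using assms by (simp add: holo_on_def)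
  fix z assume "z \<in> U"
  then obtain D E where "(f has_derivative D) (at z)" "\<forall>c v. D (c *s v) = c * D v"
    "(g has_derivative E) (at z)" "\<forall>c v. E (c *s v) = c * E v"
    using assms unfolding holo_on_def by meson
  then show "\<exists>D. ((\<lambda>z. f z + g z) has_derivative D) (at z) \<and> (\<forall>c v. D (c *s v) = c * D v)"
    by (intro exI[of _ "\<lambda>v. D v + E v"]) (auto intro!: has_derivative_add simp: algebra_simps)
qed

lemma holo_on_mult:
  assumes "holo_on f U" "holo_on g U" shows "holo_on (\<lambda>z. f z * g z) U"
  unfolding holo_on_def
proof (intro conjI ballI)
  show "open U" using assms by (simp add: holo_on_def)
  fix z assume "z \<in> U"
  then obtain D E where "(f has_derivative D) (at z)" "\<forall>c v. D (c *s v) = c * D v"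
    "(g has_derivative E) (at z)" "\<forall>c v. E (c *s v) = c * E v"
    using assms unfolding holo_on_def by meson
  then show "\<exists>D. ((\<lambda>z. f z * g z) has_derivative D) (at z) \<and> (\<forall>c v. D (c *s v) = c * D v)"
    by (intro exI[of _ "\<lambda>v. f z * E v + D v * g z"] conjI has_derivative_mult)
       (simp_all add: algebra_simps)
qed

lemma holo_near0_const: "holo_near0 (\<lambda>_. c)"
  unfolding holo_near0_def using holo_on_const[of UNIV] by blast

lemma holo_near0_common:
  assumes "holo_near0 f" "holo_near0 g"
  obtains U where "0 \<in> U" "holo_on f U" "holo_on g U"
proof -
  obtain U V where "0 \<in> U" "holo_on f U" "0 \<in> V" "holo_on g V"
    using assms unfolding holo_near0_def by blast
  then have "0 \<in> U \<inter> V" "holo_on f (U \<inter> V)" "holo_on g (U \<inter> V)"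
    by (auto intro!: holo_on_subset[of f U] holo_on_subset[of g V]) (auto simp: holo_on_def)
  then show ?thesis using that by blast
qed

lemma holo_near0_add: "holo_near0 f \<Longrightarrow> holo_near0 g \<Longrightarrow> holo_near0 (\<lambda>z. f z + g z)"
  by (metis holo_near0_common holo_near0_def holo_on_add)

lemma holo_near0_mult: "holo_near0 f \<Longrightarrow> holo_near0 g \<Longrightarrow> holo_near0 (\<lambda>z. f z * g z)"
  by (metis holo_near0_common holo_near0_def holo_on_mult)

lemma holo_near0_uminus: "holo_near0 f \<Longrightarrow> holo_near0 (\<lambda>z. - f z)"
  using holo_near0_mult[OF holo_near0_const[of "- 1"], of f] by simp

lemma holo_near0_diff: "holo_near0 f \<Longrightarrow> holo_near0 g \<Longrightarrow> holo_near0 (\<lambda>z. f z - g z)"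
  using holo_near0_add[OF _ holo_near0_uminus, of f g] by simp

text \<open>The ring \<open>\<O>\<^sub>o\<close>.\<close>

quotient_type (overloaded) 'n hol_germ = "complex^('n::finite) \<Rightarrow> complex" / partial: germ_eq
  morphisms rep_germ germ
proof (rule part_equivpI)
  show "\<exists>f::complex^'n \<Rightarrow> complex. germ_eq f f"
    by (intro exI[of _ "\<lambda>_. 0"]) (simp add: germ_eq_def holo_near0_const)
  show "symp (germ_eq :: (complex^'n \<Rightarrow> complex) \<Rightarrow> _)"
    by (auto simp: symp_def germ_eq_def elim: eventually_mono)
  show "transp (germ_eq :: (complex^'n \<Rightarrow> complex) \<Rightarrow> _)"
    by (auto simp: transp_def germ_eq_def elim: eventually_elim2)
qed

instantiation hol_germ :: (finite) comm_ring_1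
begin

lift_definition zero_hol_germ :: "'a hol_germ" is "\<lambda>_. 0"
  by (simp add: germ_eq_def holo_near0_const)

lift_definition one_hol_germ :: "'a hol_germ" is "\<lambda>_. 1"
  by (simp add: germ_eq_def holo_near0_const)

lift_definition plus_hol_germ :: "'a hol_germ \<Rightarrow> 'a hol_germ \<Rightarrow> 'a hol_germ" is "\<lambda>f g z. f z + g z"
  by (auto simp: germ_eq_def holo_near0_add elim: eventually_elim2)

lift_definition times_hol_germ :: "'a hol_germ \<Rightarrow> 'a hol_germ \<Rightarrow> 'a hol_germ" is "\<lambda>f g z. f z * g z"
  by (auto simp: germ_eq_def holo_near0_mult elim: eventually_elim2)

lift_definition minus_hol_germ :: "'a hol_germ \<Rightarrow> 'a hol_germ \<Rightarrow> 'a hol_germ" is "\<lambda>f g z. f z - g z"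
  by (auto simp: germ_eq_def holo_near0_diff elim: eventually_elim2)

lift_definition uminus_hol_germ :: "'a hol_germ \<Rightarrow> 'a hol_germ" is "\<lambda>f z. - f z"
  by (auto simp: germ_eq_def holo_near0_uminus elim: eventually_mono)

instance
proof
  show "(0 :: 'a hol_germ) \<noteq> 1"
    by transfer (auto simp: germ_eq_def eventually_nhds)
qed (transfer; auto simp: germ_eq_def algebra_simps holo_near0_const
       intro!: holo_near0_add holo_near0_mult holo_near0_diff holo_near0_uminus; fail)+

end

text \<open>The same ring as a record, giving access to the library's notions
  \<^const>\<open>ideal\<close>, \<^const>\<open>genideal\<close> and \<^const>\<open>ideal_prod\<close>.\<close>

abbreviation germ_ring :: "('n::finite) hol_germ ring" where
  "germ_ring \<equiv> ring_of_type_algebra"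

lemma germ_eq_iff: "holo_near0 f \<Longrightarrow> holo_near0 g \<Longrightarrow> germ f = germ g \<longleftrightarrow> (\<forall>\<^sub>F z in nhds 0. f z = g z)"
  using Quotient3_rel[OF Quotient3_hol_germ, of f g] by (auto simp: germ_eq_def)


section \<open>Plurisubharmonic functions\<close>

text \<open>Lebesgue integral of an extended real function. It is meaningful when the positive or the
  negative part has finite integral; below, the positive part is always bounded and the
  underlying measure finite.\<close>

definition ereal_integral :: "'a measure \<Rightarrow> ('a \<Rightarrow> ereal) \<Rightarrow> ereal" where
  "ereal_integral M f =
     enn2ereal (\<integral>\<^sup>+x. e2ennreal (f x) \<partial>M) - enn2ereal (\<integral>\<^sup>+x. e2ennreal (- f x) \<partial>M)"

definition psh_on :: "(complex^'n) set \<Rightarrow> (complex^'n \<Rightarrow> ereal) \<Rightarrow> bool" where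
  "psh_on U u \<longleftrightarrow> open U \<and> connected U \<and>
     (\<forall>z\<in>U. u z < \<infinity>) \<and> (\<exists>z\<in>U. u z \<noteq> -\<infinity>) \<and>
     (\<forall>a\<in>U. \<forall>t>u a. \<forall>\<^sub>F z in at a. u z < t) \<and>
     (\<forall>a w. (\<forall>\<zeta>. norm \<zeta> \<le> 1 \<longrightarrow> a + \<zeta> *s w \<in> U) \<longrightarrow>
        u a \<le> ereal_integral (lebesgue_on {0..2*pi}) (\<lambda>\<theta>. u (a + cis \<theta> *s w)) / ereal (2*pi))"


section \<open>Multiplier ideals and jumping numbers\<close>

definition exp_ereal :: "ereal \<Rightarrow> ennreal" where
  "exp_ereal x = (case x of ereal r \<Rightarrow> ennreal (exp r) | PInfty \<Rightarrow> \<infinity> | MInfty \<Rightarrow> 0)"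

definition ln_ereal :: "real \<Rightarrow> ereal" where
  "ln_ereal x = (if x = 0 then -\<infinity> else ereal (ln x))"

definition sq_integrable_near0 :: "(complex^'n \<Rightarrow> complex) \<Rightarrow> (complex^'n \<Rightarrow> ereal) \<Rightarrow> bool" where
  "sq_integrable_near0 f u \<longleftrightarrow> (\<exists>V. open V \<and> 0 \<in> V \<and>
     (\<integral>\<^sup>+z\<in>V. ennreal ((norm (f z))\<^sup>2) * exp_ereal (- (2 * u z)) \<partial>lborel) < \<infinity>)"

text \<open>The stalk \<open>\<I>(u)\<^sub>o\<close>.\<close>

definition multiplier_ideal :: "(complex^'n \<Rightarrow> ereal) \<Rightarrow> ('n::finite) hol_germ set" where
  "multiplier_ideal u = {germ f | f. holo_near0 f \<and> sq_integrable_near0 f u}"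

lemma sq_integrable_near0_cong:
  assumes "\<forall>\<^sub>F z in nhds 0. f z = g z" "sq_integrable_near0 f u"
  shows "sq_integrable_near0 g u"
proof -
  obtain S where S: "open S" "0 \<in> S" "\<And>z. z \<in> S \<Longrightarrow> f z = g z"
    using assms(1) by (auto simp: eventually_nhds)
  obtain V where V: "open V" "0 \<in> V"
    "(\<integral>\<^sup>+z\<in>V. ennreal ((norm (f z))\<^sup>2) * exp_ereal (- (2 * u z)) \<partial>lborel) < \<infinity>"
    using assms(2) by (auto simp: sq_integrable_near0_def)
  have "(\<integral>\<^sup>+z\<in>S \<inter> V. ennreal ((norm (g z))\<^sup>2) * exp_ereal (- (2 * u z)) \<partial>lborel)
      \<le> (\<integral>\<^sup>+z\<in>V. ennreal ((norm (f z))\<^sup>2) * exp_ereal (- (2 * u z)) \<partial>lborel)"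
    by (intro nn_integral_mono) (auto simp: indicator_def S(3))
  with S V show ?thesis
    unfolding sq_integrable_near0_def by (intro exI[of _ "S \<inter> V"]) auto
qed

lemma germ_in_multiplier_ideal_iff:
  assumes "holo_near0 f"
  shows "germ f \<in> multiplier_ideal u \<longleftrightarrow> sq_integrable_near0 f u"
proof
  assume "germ f \<in> multiplier_ideal u"
  then obtain g where "holo_near0 g" "sq_integrable_near0 g u" "germ g = germ f"
    by (auto simp: multiplier_ideal_def)
  then show "sq_integrable_near0 f u"
    using assms germ_eq_iff sq_integrable_near0_cong by blast
qed (use assms in \<open>auto simp: multiplier_ideal_def\<close>)

text \<open>For \<open>c = 0\<close> the weight is \<open>0\<close> everywhere, also where \<open>u = -\<infinity>\<close>, as \<open>0 * -\<infinity> = 0\<close> in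
  \<^typ>\<open>ereal\<close>; hence the set below always contains \<open>0\<close>.\<close>

definition jumping_number :: "('n::finite) hol_germ set \<Rightarrow> (complex^'n \<Rightarrow> ereal) \<Rightarrow> ereal" where
  "jumping_number I u = Sup {ereal c | c. 0 \<le> c \<and> I \<subseteq> multiplier_ideal (\<lambda>z. ereal c * u z)}"

definition generators :: "(complex^'n \<Rightarrow> complex) list \<Rightarrow> ('n::finite) hol_germ set \<Rightarrow> bool" where
  "generators gs J \<longleftrightarrow> (\<forall>g\<in>set gs. holo_near0 g) \<and> J = genideal germ_ring (germ ` set gs)"

text \<open>\<open>log |J|\<close> for the ideal \<open>J\<close> generated by the list \<open>gs\<close>.\<close>

definition log_modulus :: "(complex^'n \<Rightarrow> complex) list \<Rightarrow> complex^'n \<Rightarrow> ereal" where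
  "log_modulus gs z = ln_ereal (\<Sum>g\<leftarrow>gs. norm (g z))"

end

theory Submission
  imports Defs "HOL-Complex_Analysis.Cauchy_Integral_Formula"
begin

text \<open>The inequality is an interpolation between two weights. Suppose that
  \<open>|I|\<^sup>2 |J|\<^sup>-\<^sup>2\<^sup>d\<close> and \<open>|I|\<^sup>2 |J|\<^sup>2 e\<^sup>-\<^sup>2\<^sup>c\<^sup>u\<close> are integrable near the origin and put
  \<open>b = d c / (1 + d)\<close>. Pointwise, \<open>e\<^sup>-\<^sup>2\<^sup>b\<^sup>u\<close> is at most \<open>|J|\<^sup>2 e\<^sup>-\<^sup>2\<^sup>c\<^sup>u + |J|\<^sup>-\<^sup>2\<^sup>d\<close>
  (\<open>young_weights\<close>), so \<open>|I|\<^sup>2 e\<^sup>-\<^sup>2\<^sup>b\<^sup>u\<close> is integrable as well and \<open>b\<close> is at most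
  \<open>c\<^sub>0\<close>, the jumping number of \<open>I\<close> (\<open>multiplier_ideal_interpolate\<close>). This says
  \<open>d (c - c\<^sub>0) \<le> c\<^sub>0\<close>, and the suprema over \<open>c\<close> and \<open>d\<close> give the claim as soon as
  \<open>c\<^sub>0 > 0\<close>: if the jumping numbers of \<open>I\<close> and \<open>I J\<close> agree, the quotient
  is then \<open>\<infinity>\<close>, whereas \<open>0 / 0\<close> would be \<open>0\<close>.

  That \<open>c\<^sub>0 > 0\<close> is a weak form of Skoda's theorem: for plurisubharmonic \<open>u\<close> some
  \<open>e\<^sup>-\<^sup>2\<^sup>c\<^sup>u\<close> with \<open>c > 0\<close> is integrable near any given point (\<open>psh_exp_integrable\<close>).
  Most of the text proves it by potential theory on discs. Let \<open>\<phi>\<close> be subharmonic on the unit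
  disc with \<open>\<phi> \<le> M\<close> and \<open>\<phi> 0 \<ge> M - K\<close>, and let \<open>E\<close> be a compact subset of the segment
  \<open>[1/8, 1/4]\<close> on which \<open>\<phi> < M - K t\<close>. The logarithmic potential of \<open>E\<close>, normalised to be
  nonpositive on the unit circle, is harmonic off \<open>E\<close>, at least \<open>|E|\<close> at \<open>0\<close>, and bounded by
  \<open>|E| (2 ln (1/|E|) + 12)\<close>. By the maximum principle, \<open>\<phi>\<close> plus a suitable multiple of the
  potential stays below \<open>M\<close>; at \<open>0\<close> this reads \<open>t \<le> 2 ln (1/|E|) + 12\<close>. Hence the length of
  \<open>E\<close> decays exponentially in \<open>t\<close> (\<open>disc_sublevel\<close>).

  Applying this on every complex line through a point \<open>b\<close> with \<open>u b > -\<infinity>\<close> and integrating over the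
  lines bounds the volume of the sublevel sets of \<open>u\<close> near \<open>b\<close>, with the same
  exponential decay, and summation over the levels makes some \<open>e\<^sup>-\<^sup>2\<^sup>c\<^sup>u\<close> integrable on a ball around
  \<open>b\<close> whose radius does not depend on \<open>u b\<close>. Connectedness of the domain then excludes
  that \<open>u = -\<infinity>\<close> on a nonempty open set, so that each point lies in such a ball.\<close>

section \<open>The maximum principle on the unit disc\<close>

text \<open>If no maximum existed, the open sets on which \<open>F\<close> stays below some larger value of \<open>F\<close>
  would cover \<open>K\<close>; the largest of these values in a finite subcover is itself
  exceeded by no value of \<open>F\<close>, a contradiction.\<close>
lemma usc_attains_sup:
  fixes F :: "'a::topological_space \<Rightarrow> ereal"
  assumes "compact K" "z0 \<in> K"
    and usc: "\<And>z t. z \<in> K \<Longrightarrow> F z < t \<Longrightarrow> \<exists>T. open T \<and> z \<in> T \<and> (\<forall>x\<in>T \<inter> K. F x < t)"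
  obtains z where "z \<in> K" "\<And>x. x \<in> K \<Longrightarrow> F x \<le> F z"
proof (rule ccontr)
  assume "\<not> thesis"
  then have "\<forall>z\<in>K. \<exists>x\<in>K. F z < F x" using that by (meson not_le)
  then obtain g where g: "\<And>z. z \<in> K \<Longrightarrow> g z \<in> K \<and> F z < F (g z)" by metis
  have "\<forall>z\<in>K. \<exists>T. open T \<and> z \<in> T \<and> (\<forall>x\<in>T \<inter> K. F x < F (g z))"
    using usc g by blast
  then obtain T where T: "\<And>z. z \<in> K \<Longrightarrow> open (T z) \<and> z \<in> T z \<and> (\<forall>x\<in>T z \<inter> K. F x < F (g z))"
    by metis
  obtain C where C: "C \<subseteq> K" "finite C" "K \<subseteq> (\<Union>c\<in>C. T c)"
    using compactE_image[OF \<open>compact K\<close>, of K T] T by blast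
  have "C \<noteq> {}" using C(3) \<open>z0 \<in> K\<close> by auto
  define m where "m = Max ((\<lambda>c. F (g c)) ` C)"
  have "m \<in> (\<lambda>c. F (g c)) ` C" unfolding m_def using C(2) \<open>C \<noteq> {}\<close> by (intro Max_in) auto
  then obtain c where c: "c \<in> C" "m = F (g c)" by auto
  then obtain d where "d \<in> C" "g c \<in> T d" using C g by blast
  then have "m < F (g d)" using T[of d] g[of c] c C(1) by auto
  moreover have "F (g d) \<le> m" unfolding m_def using C(2) \<open>d \<in> C\<close> by auto
  ultimately show False by simp
qed

text \<open>Circular means of \<open>-\<infinity>\<close>-valued functions enter the maximum principle only through
  this comparison with a continuous majorant.\<close>
lemma ereal_integral_le_real_integral:
  fixes f :: "real \<Rightarrow> ereal" and h :: "real \<Rightarrow> real"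
  assumes cont: "continuous_on {a..b} h"
    and le: "\<And>x. x \<in> {a..b} \<Longrightarrow> f x \<le> ereal (h x)"
  shows "ereal_integral (lebesgue_on {a..b}) f \<le> ereal (integral {a..b} h)"
proof -
  let ?M = "lebesgue_on {a..b}"
  have int: "integrable ?M h" using cont by (rule continuous_imp_integrable_real)
  then have fin: "(\<integral>\<^sup>+x. ennreal (h x) \<partial>?M) < \<infinity>" "(\<integral>\<^sup>+x. ennreal (- h x) \<partial>?M) < \<infinity>"
    unfolding real_integrable_def by (auto simp: less_top)
  have 1: "(\<integral>\<^sup>+x. e2ennreal (f x) \<partial>?M) \<le> (\<integral>\<^sup>+x. ennreal (h x) \<partial>?M)"
    by (intro nn_integral_mono) (use e2ennreal_mono[OF le] in \<open>auto simp: e2ennreal_ereal\<close>)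
  have 2: "(\<integral>\<^sup>+x. ennreal (- h x) \<partial>?M) \<le> (\<integral>\<^sup>+x. e2ennreal (- f x) \<partial>?M)"
  proof (intro nn_integral_mono)
    fix x assume "x \<in> space ?M"
    then have "ereal (- h x) \<le> - f x" using le[of x] by (simp flip: uminus_ereal.simps)
    from e2ennreal_mono[OF this] show "ennreal (- h x) \<le> e2ennreal (- f x)"
      by (simp add: e2ennreal_ereal)
  qed
  have "integral {a..b} h = integral\<^sup>L ?M h" using int by (simp add: lebesgue_integral_eq_integral)
  also have "\<dots> = enn2real (\<integral>\<^sup>+x. ennreal (h x) \<partial>?M) - enn2real (\<integral>\<^sup>+x. ennreal (- h x) \<partial>?M)"
    by (rule real_lebesgue_integral_def[OF int])
  finally have "ereal (integral {a..b} h)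
      = enn2ereal (\<integral>\<^sup>+x. ennreal (h x) \<partial>?M) - enn2ereal (\<integral>\<^sup>+x. ennreal (- h x) \<partial>?M)"
    using fin by (cases "\<integral>\<^sup>+x. ennreal (h x) \<partial>?M"; cases "\<integral>\<^sup>+x. ennreal (- h x) \<partial>?M") (auto simp: enn2ereal_ennreal)
  then show ?thesis unfolding ereal_integral_def
    using 1 2 by (auto simp flip: less_eq_ennreal.rep_eq intro!: ereal_minus_mono)
qed

text \<open>The mean value property of \<open>ln |w - s|\<close>, from Cauchy's formula. On the disc the quotient
  \<open>(w - s) / (z - s)\<close> is within distance \<open>1\<close> of \<open>1\<close>, so the principal branch of its logarithm is
  holomorphic there.\<close>
lemma log_circle_mean:
  assumes "0 < r" "s \<notin> cball z r"
  shows "((\<lambda>\<theta>. ln (cmod (z + of_real r * cis \<theta> - s))) has_integral 2 * pi * ln (cmod (z - s))) {0..2*pi}"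
proof -
  have zs: "r < cmod (z - s)" "z \<noteq> s" using assms by (auto simp: dist_norm)
  define g where "g w = (w - s) / (z - s)" for w
  have nonneg: "g w \<notin> \<real>\<^sub>\<le>\<^sub>0" "cmod (g w) \<noteq> 0" if "w \<in> cball z r" for w
  proof -
    have "cmod (g w - 1) = cmod (w - z) / cmod (z - s)"
      using zs by (simp add: g_def norm_divide[symmetric] field_simps)
    also have "\<dots> < 1" using that zs assms(1) by (simp add: dist_norm norm_minus_commute divide_simps)
    finally have "Re (g w) > 0" using abs_Re_le_cmod[of "g w - 1"] by simp
    then show "g w \<notin> \<real>\<^sub>\<le>\<^sub>0" "cmod (g w) \<noteq> 0" by (auto simp: complex_nonpos_Reals_iff)
  qed
  have "(\<lambda>w. Ln (g w)) holomorphic_on cball z r"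
    using nonneg zs unfolding g_def by (intro holomorphic_intros) auto
  then have "((\<lambda>u. Ln (g u) / (u - z)) has_contour_integral (2 * of_real pi * \<i> * Ln (g z))) (circlepath z r)"
    using assms(1) by (intro Cauchy_integral_circlepath_simple) auto
  then have "((\<lambda>u. Ln (g u) / (u - z)) has_contour_integral 0) (part_circlepath z r 0 (2*pi))"
    using zs by (simp add: g_def circlepath_def)
  then have "((\<lambda>t. Ln (g (z + r * cis t)) / (r * cis t) * r * \<i> * cis t) has_integral 0) {0..2*pi}"
    by (subst (asm) has_contour_integral_part_circlepath_iff) auto
  then have "((\<lambda>t. \<i> * Ln (g (z + r * cis t))) has_integral 0) {0..2*pi}"
    using assms(1) by (simp add: field_simps)
  from has_integral_linear[OF this bounded_linear_Im]
  have "((\<lambda>t. Re (Ln (g (z + r * cis t)))) has_integral 0) {0..2*pi}"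
    by (simp add: o_def)
  from has_integral_add[OF this has_integral_const_real[of "ln (cmod (z - s))" 0 "2*pi"]]
  have *: "((\<lambda>t. Re (Ln (g (z + r * cis t))) + ln (cmod (z - s))) has_integral 2 * pi * ln (cmod (z - s))) {0..2*pi}"
    by simp
  show ?thesis
  proof (rule has_integral_eq[OF _ *])
    fix t assume "t \<in> {0..2*pi}"
    have "z + r * cis t \<in> cball z r" using assms(1) by (simp add: dist_norm norm_mult)
    from nonneg(2)[OF this] zs show "Re (Ln (g (z + r * cis t))) + ln (cmod (z - s)) = ln (cmod (z + r * cis t - s))"
      by (simp add: g_def Re_Ln norm_divide ln_div)
  qed
qed

text \<open>Upper semicontinuity is required in full neighbourhoods of the points of the closed disc,
  as is natural for restrictions of functions that are defined on a larger open set.\<close>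
definition subharmonic_disc :: "(complex \<Rightarrow> ereal) \<Rightarrow> bool" where
  "subharmonic_disc \<phi> \<longleftrightarrow>
     (\<forall>z\<in>cball 0 1. \<phi> z < \<infinity> \<and> (\<forall>t>\<phi> z. \<forall>\<^sub>F x in nhds z. \<phi> x < t)) \<and>
     (\<forall>z r. 0 < r \<longrightarrow> cball z r \<subseteq> cball 0 1 \<longrightarrow>
        \<phi> z \<le> ereal_integral (lebesgue_on {0..2*pi}) (\<lambda>\<theta>. \<phi> (z + of_real r * cis \<theta>)) / ereal (2*pi))"

lemma sq_circle_mean:
  "((\<lambda>\<theta>. (cmod (z + of_real r * cis \<theta>))\<^sup>2) has_integral 2 * pi * ((cmod z)\<^sup>2 + r\<^sup>2)) {0..2*pi}"
proof -
  have "((\<lambda>\<theta>. (cmod z)\<^sup>2 + r\<^sup>2 + 2 * r * (Re z * cos \<theta> + Im z * sin \<theta>)) has_integral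
      (((cmod z)\<^sup>2 + r\<^sup>2) * (2*pi) + 2 * r * (Re z * sin (2*pi) - Im z * cos (2*pi)))
      - (((cmod z)\<^sup>2 + r\<^sup>2) * 0 + 2 * r * (Re z * sin 0 - Im z * cos 0))) {0..2*pi}"
    by (intro fundamental_theorem_of_calculus)
       (auto intro!: derivative_eq_intros simp: has_real_derivative_iff_has_vector_derivative[symmetric] algebra_simps)
  moreover have "(cmod (z + of_real r * cis \<theta>))\<^sup>2
      = (cmod z)\<^sup>2 + r\<^sup>2 + 2 * r * (Re z * cos \<theta> + Im z * sin \<theta>)" for \<theta>
  proof -
    have "r\<^sup>2 = r\<^sup>2 * (sin \<theta>)\<^sup>2 + r\<^sup>2 * (cos \<theta>)\<^sup>2"
      by (metis distrib_left mult.right_neutral sin_cos_squared_add)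
    then show ?thesis unfolding cmod_power2 by (simp add: power2_eq_square algebra_simps)
  qed
  ultimately show ?thesis by (simp add: mult.commute)
qed

text \<open>A maximum principle for \<open>\<phi> + p\<close> on the complement of \<open>E\<close>, where \<open>p\<close> is harmonic. Near
  \<open>E\<close> the value of \<open>\<phi>\<close> is so small that \<open>\<phi> + p \<le> M\<close>; this gives control without any
  continuity of \<open>p\<close> at the points of \<open>E\<close>. Adding a small multiple of \<open>|z|\<^sup>2 - 1\<close> makes the sub-mean
  value inequality strict, so a maximum above \<open>M\<close> is contradicted by a single circle around it.\<close>
lemma disc_maximum_principle:
  assumes sh: "subharmonic_disc \<phi>" and E: "compact E" "E \<subseteq> ball 0 1"
    and cont: "continuous_on (cball 0 1 - E) p"
    and mean: "\<And>z r. 0 < r \<Longrightarrow> cball z r \<subseteq> cball 0 1 - E \<Longrightarrow>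
        ((\<lambda>\<theta>. p (z + of_real r * cis \<theta>)) has_integral 2 * pi * p z) {0..2*pi}"
    and M: "\<And>z. z \<in> cball 0 1 \<Longrightarrow> \<phi> z \<le> ereal M"
    and bdry: "\<And>z. cmod z = 1 \<Longrightarrow> p z \<le> 0"
    and onE: "\<And>z. z \<in> E \<Longrightarrow> \<phi> z < ereal (M - L)"
    and pL: "\<And>z. z \<in> cball 0 1 - E \<Longrightarrow> p z \<le> L"
    and z0: "z0 \<in> cball 0 1 - E"
  shows "\<phi> z0 + ereal (p z0) \<le> ereal M"
proof (rule ccontr)
  assume "\<not> ?thesis"
  then have gt: "ereal M < \<phi> z0 + ereal (p z0)" by simp
  have "\<phi> z0 \<le> ereal M" using M z0 by auto
  with gt obtain v0 where v0: "\<phi> z0 = ereal v0" by (cases "\<phi> z0") auto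
  \<comment> \<open>Half of the excess at \<open>z0\<close>: the perturbation below costs at most \<open>\<epsilon>\<close> there.\<close>
  define \<epsilon> where "\<epsilon> = (v0 + p z0 - M) / 2"
  have "\<epsilon> > 0" using gt v0 by (simp add: \<epsilon>_def)
  define q where "q z = p z + \<epsilon> * ((cmod z)\<^sup>2 - 1)" for z
  \<comment> \<open>The sum, truncated from below at \<open>M\<close> and extended by \<open>M\<close> to \<open>E\<close>, is upper semicontinuous on the whole closed disc.\<close>
  define F where "F z = (if z \<in> E then ereal M else max (ereal M) (\<phi> z + ereal (q z)))" for z
  have q_le: "q z \<le> p z" if "z \<in> cball 0 1" for z
    using that \<open>\<epsilon> > 0\<close> by (auto simp: q_def mult_le_0_iff abs_square_le_1)
  have qcont: "continuous_on (cball 0 1 - E) q"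
    unfolding q_def by (intro continuous_intros cont)
  have usc: "\<exists>T. open T \<and> z \<in> T \<and> (\<forall>x\<in>T \<inter> cball 0 1. F x < t)" if z: "z \<in> cball 0 1" "F z < t" for z t
  proof (cases "z \<in> E")
    case True
    then have "\<forall>\<^sub>F x in nhds z. \<phi> x < ereal (M - L)"
      using sh onE z unfolding subharmonic_disc_def by blast
    then obtain T where T: "open T" "z \<in> T" "\<And>x. x \<in> T \<Longrightarrow> \<phi> x < ereal (M - L)"
      by (auto simp: eventually_nhds)
    have "F x < t" if x: "x \<in> T \<inter> cball 0 1" for x
    proof -
      have "\<phi> x + ereal (q x) \<le> ereal M" if "x \<notin> E"
      proof -
        have "\<phi> x + ereal (q x) \<le> ereal (M - L) + ereal L"
          using T(3)[of x] q_le[of x] pL[of x] x that by (intro add_mono) auto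
        then show ?thesis by simp
      qed
      then show ?thesis using True z(2) by (auto simp: F_def max_def)
    qed
    with T show ?thesis by blast
  next
    case False
    with z(2) have t: "ereal M < t" "\<phi> z + ereal (q z) < t" by (auto simp: F_def)
    then obtain y where y: "\<phi> z + ereal (q z) < ereal y" "ereal y < t" using ereal_dense2 by blast
    have "\<phi> z \<noteq> \<infinity>" using M[OF z(1)] by auto
    then have "\<phi> z < ereal (y - q z)" using y(1) by (cases "\<phi> z") auto
    then obtain y' where y': "\<phi> z < ereal y'" "ereal y' < ereal (y - q z)" using ereal_dense2 by blast
    have "\<forall>\<^sub>F x in nhds z. \<phi> x < ereal y'"
      using sh z(1) y'(1) unfolding subharmonic_disc_def by blast
    then obtain T where T: "open T" "z \<in> T" "\<And>x. x \<in> T \<Longrightarrow> \<phi> x < ereal y'"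
      by (auto simp: eventually_nhds)
    have "\<forall>\<^sub>F x in at z within (cball 0 1 - E). q x < y - y'"
      using qcont z(1) False y'(2) unfolding continuous_on_def
      by (intro order_tendstoD(2)[of _ "q z"]) auto
    then obtain S where S: "open S" "z \<in> S" "\<And>x. x \<in> S \<Longrightarrow> x \<noteq> z \<Longrightarrow> x \<in> cball 0 1 - E \<Longrightarrow> q x < y - y'"
      unfolding eventually_at_topological by auto
    have S': "q x < y - y'" if "x \<in> S" "x \<in> cball 0 1 - E" for x
      using S(3)[of x] that y'(2) by (cases "x = z") auto
    have "F x < t" if x: "x \<in> (T \<inter> S) \<inter> cball 0 1" for x
    proof (cases "x \<in> E")
      case False
      then have "\<phi> x + ereal (q x) \<le> ereal y' + ereal (y - y')"
        using T(3)[of x] S'[of x] x by (intro add_mono) auto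
      also have "\<dots> < t" using y(2) by simp
      finally show ?thesis using t(1) False by (simp add: F_def)
    qed (use t in \<open>simp add: F_def\<close>)
    then show ?thesis using T S by (intro exI[of _ "T \<inter> S"]) auto
  qed
  obtain a where a: "a \<in> cball 0 1" "\<And>x. x \<in> cball 0 1 \<Longrightarrow> F x \<le> F a"
    using usc_attains_sup[of "cball 0 1" z0 F] usc z0 by auto
  have "0 \<le> \<epsilon> * (cmod z0)\<^sup>2" using \<open>\<epsilon> > 0\<close> by simp
  moreover have "v0 + p z0 = M + 2 * \<epsilon>" by (simp add: \<epsilon>_def)
  ultimately have "M < v0 + q z0" using \<open>\<epsilon> > 0\<close> unfolding q_def right_diff_distrib by linarith
  then have "ereal M < F z0" using z0 by (simp add: F_def v0 less_max_iff_disj)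
  then have Ma: "ereal M < F a" using a(2)[of z0] z0 by auto
  then have aE: "a \<notin> E" by (auto simp: F_def)
  have Fa: "F a = \<phi> a + ereal (q a)" using Ma aE by (auto simp: F_def max_def split: if_splits)
  have a1: "cmod a < 1"
  proof (rule ccontr)
    assume "\<not> cmod a < 1"
    then have "cmod a = 1" using a(1) by auto
    then have "q a \<le> 0" using bdry[of a] by (simp add: q_def)
    then have "F a \<le> ereal M + ereal 0" unfolding Fa using M[OF a(1)] by (intro add_mono) auto
    with Ma show False by auto
  qed
  obtain va where va: "\<phi> a = ereal va" using Fa Ma M[OF a(1)] by (cases "\<phi> a") auto
  have "open (ball 0 1 - E)" using E(1) by (simp add: compact_imp_closed open_Diff)
  moreover have "a \<in> ball 0 1 - E" using a1 aE by simp
  ultimately obtain r where r: "r > 0" "cball a r \<subseteq> ball 0 1 - E"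
    using open_contains_cball_eq by blast
  then have r': "cball a r \<subseteq> cball 0 1 - E" using ball_subset_cball by blast
  have circ: "a + of_real r * cis \<theta> \<in> cball 0 1 - E" for \<theta>
    using r'[THEN subsetD, of "a + of_real r * cis \<theta>"] r(1) by (simp add: dist_norm norm_mult)
  \<comment> \<open>The maximality of \<open>a\<close> bounds \<open>\<phi>\<close> on the circle by a continuous function.\<close>
  define h where "h \<theta> = va + q a - q (a + of_real r * cis \<theta>)" for \<theta>
  have le: "\<phi> (a + of_real r * cis \<theta>) \<le> ereal (h \<theta>)" for \<theta>
  proof -
    let ?x = "a + of_real r * cis \<theta>"
    have "\<phi> ?x + ereal (q ?x) \<le> F ?x" using circ[of \<theta>] by (simp add: F_def)
    also have "\<dots> \<le> ereal (va + q a)" using a(2)[of ?x] circ[of \<theta>] Fa va by simp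
    finally show ?thesis by (cases "\<phi> ?x") (auto simp: h_def)
  qed
  have hcont: "continuous_on {0..2*pi} h" unfolding h_def
    by (intro continuous_intros continuous_on_compose2[OF qcont]) (use circ in auto)
  have "((\<lambda>\<theta>. (cmod (a + of_real r * cis \<theta>))\<^sup>2 - 1) has_integral 2 * pi * ((cmod a)\<^sup>2 + r\<^sup>2) - 2 * pi) {0..2*pi}"
    using has_integral_diff[OF sq_circle_mean[of a r] has_integral_const_real[of 1 0 "2*pi"]] by simp
  from has_integral_add[OF mean[OF r(1) r'] has_integral_mult_right[OF this, of \<epsilon>]]
  have "((\<lambda>\<theta>. q (a + of_real r * cis \<theta>)) has_integral 2*pi*p a + \<epsilon> * (2 * pi * ((cmod a)\<^sup>2 + r\<^sup>2) - 2 * pi)) {0..2*pi}"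
    unfolding q_def by simp
  from has_integral_diff[OF has_integral_const_real[of "va + q a" 0 "2*pi"] this]
  have "(h has_integral 2 * pi * (va + q a) - (2*pi*p a + \<epsilon> * (2 * pi * ((cmod a)\<^sup>2 + r\<^sup>2) - 2 * pi))) {0..2*pi}"
    by (simp add: h_def[abs_def])
  then have hint: "integral {0..2*pi} h = 2 * pi * (va - \<epsilon> * r\<^sup>2)"
    by (simp add: integral_unique q_def algebra_simps)
  have "\<phi> a \<le> ereal_integral (lebesgue_on {0..2*pi}) (\<lambda>\<theta>. \<phi> (a + of_real r * cis \<theta>)) / ereal (2*pi)"
    using sh r(1) r' unfolding subharmonic_disc_def by blast
  also have "\<dots> \<le> ereal (integral {0..2*pi} h) / ereal (2*pi)"
    using ereal_integral_le_real_integral[OF hcont le] by (intro ereal_divide_right_mono) auto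
  also have "\<dots> = ereal (va - \<epsilon> * r\<^sup>2)" by (simp add: hint)
  finally have "\<epsilon> * r\<^sup>2 \<le> 0" using va by simp
  then show False using \<open>\<epsilon> > 0\<close> r(1) by (simp add: mult_le_0_iff)
qed

section \<open>The logarithmic potential of a compact subset of a segment\<close>

text \<open>The logarithmic kernel will be dominated by \<open>1 / sqrt |s - x|\<close>, whose primitive is elementary.
  The window \<open>[x - 2, x + 2]\<close> contains the segment \<open>[0, 1]\<close> whenever \<open>|x| \<le> 1\<close>.\<close>
lemma inv_sqrt_kernel:
  fixes x :: real
  defines "f \<equiv> \<lambda>s. indicator {x-2..x+2} s * (1 / sqrt \<bar>s - x\<bar>)"
  shows "integrable lborel f" "integral\<^sup>L lborel f \<le> 6"
proof -
  have 1: "((\<lambda>s. 1 / sqrt \<bar>s - x\<bar>) has_integral 2 * sqrt (x + 2 - x) - 2 * sqrt (x - x)) {x..x+2}"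
    by (rule fundamental_theorem_of_calculus_interior)
       (auto intro!: continuous_intros derivative_eq_intros
             simp: has_real_derivative_iff_has_vector_derivative[symmetric] field_simps)
  have 2: "((\<lambda>s. 1 / sqrt \<bar>s - x\<bar>) has_integral - (2 * sqrt (x - x)) - - (2 * sqrt (x - (x - 2)))) {x-2..x}"
    by (rule fundamental_theorem_of_calculus_interior)
       (auto intro!: continuous_intros derivative_eq_intros
             simp: has_real_derivative_iff_has_vector_derivative[symmetric] field_simps)
  have "((\<lambda>s. 1 / sqrt \<bar>s - x\<bar>) has_integral 4 * sqrt 2) {x-2..x+2}"
    using has_integral_combine[OF _ _ 2 1] by simp
  then have nn: "(\<integral>\<^sup>+s. ennreal (f s) \<partial>lborel) = ennreal (4 * sqrt 2)"
    unfolding f_def by (intro nn_integral_has_integral_lebesgue) auto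
  have fm: "f \<in> borel_measurable lborel" unfolding f_def by measurable
  show "integrable lborel f"
    by (intro integrableI_nn_integral_finite[OF fm _ nn]) (auto simp: f_def)
  have "integral\<^sup>L lborel f = 4 * sqrt 2"
    by (intro integral_eq_nn_integral[THEN trans]) (use fm nn in \<open>auto simp: f_def\<close>)
  also have "4 * sqrt 2 = sqrt (16 * 2)" by (simp only: real_sqrt_mult) simp
  also have "sqrt (16 * 2) \<le> sqrt (6\<^sup>2)" by (intro real_sqrt_le_mono) simp
  finally show "integral\<^sup>L lborel f \<le> 6" by simp
qed

text \<open>The constant \<open>ln (3/4)\<close> makes the potential nonpositive on the unit circle if
  \<open>E\<close> lies in \<open>[1/8, 1/4]\<close>, as such points have distance at least \<open>3/4\<close> from the circle.\<close>
definition log_pot :: "real set \<Rightarrow> complex \<Rightarrow> real" where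
  "log_pot E z = (LINT s|lborel. indicator E s * (ln (3/4) - ln (cmod (z - of_real s))))"

context
  fixes E :: "real set"
  assumes E: "compact E"
begin

lemma log_pot_integrable:
  assumes "z \<notin> of_real ` E"
  shows "integrable lborel (\<lambda>s. indicator E s * (ln (3/4) - ln (cmod (z - of_real s))))"
proof -
  have "continuous_on E (\<lambda>s. ln (3/4) - ln (cmod (z - of_real s)))"
    using assms by (intro continuous_intros) auto
  from borel_integrable_compact[OF E this] show ?thesis by simp
qed

lemma integrable_indicator_compact: "integrable lborel (\<lambda>s. indicator E s * (c::real))"
  using borel_integrable_compact[OF E, of "\<lambda>_. c"] by simp

lemma integral_indicator_compact: "(LINT s|lborel. indicator E s * c) = measure lborel E * (c::real)"
  using E by (simp add: borel_compact mult.commute)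

text \<open>Off \<open>E\<close> the kernel is Lipschitz in \<open>z\<close> with a constant governed by the distance to \<open>E\<close>.\<close>
lemma log_pot_continuous: "continuous_on (- of_real ` E) (log_pot E)"
  unfolding continuous_on_iff
proof (intro ballI allI impI)
  fix z :: complex and e assume z: "z \<in> - of_real ` E" and e: "(e::real) > 0"
  let ?C = "of_real ` E :: complex set"
  have "closed ?C" using E by (intro compact_imp_closed compact_continuous_image continuous_intros)
  then obtain d where d: "d > 0" "ball z d \<subseteq> - ?C"
    using z open_contains_ball by (metis open_Compl)
  define m where "m = measure lborel E"
  have "m \<ge> 0" by (simp add: m_def)
  define \<delta> where "\<delta> = min (d / 2) (e * d / (2 * (m + 1)))"
  have "\<delta> > 0" using d e \<open>m \<ge> 0\<close> by (simp add: \<delta>_def)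
  moreover have "dist (log_pot E y) (log_pot E z) < e" if y: "y \<in> - ?C" "dist y z < \<delta>" for y
  proof -
    define c where "c = dist y z * (2 / d)"
    have ln_le: "\<bar>ln (cmod (z - of_real s)) - ln (cmod (y - of_real s))\<bar> \<le> c" if "s \<in> E" for s
    proof -
      have zs: "d \<le> cmod (z - of_real s)" using d(2) that by (force simp: dist_norm subset_iff)
      have "cmod (z - of_real s) \<le> dist y z + cmod (y - of_real s)"
        by (metis dist_commute dist_norm dist_triangle)
      then have ys: "d / 2 \<le> cmod (y - of_real s)" using zs y(2) by (simp add: \<delta>_def)
      have tri: "\<bar>cmod (z - of_real s) - cmod (y - of_real s)\<bar> \<le> dist y z"
        using norm_triangle_ineq3[of "z - of_real s" "y - of_real s"] by (simp add: dist_norm norm_minus_commute)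
      have "ln (cmod (z - of_real s)) - ln (cmod (y - of_real s))
          \<le> (cmod (z - of_real s) - cmod (y - of_real s)) / cmod (y - of_real s)"
        using zs ys d(1) by (intro ln_diff_le) linarith+
      also have "\<dots> \<le> dist y z / (d / 2)" using tri ys d(1) by (intro frac_le) auto
      finally have a: "ln (cmod (z - of_real s)) - ln (cmod (y - of_real s)) \<le> c" by (simp add: c_def)
      have "ln (cmod (y - of_real s)) - ln (cmod (z - of_real s))
          \<le> (cmod (y - of_real s) - cmod (z - of_real s)) / cmod (z - of_real s)"
        using zs ys d(1) by (intro ln_diff_le) linarith+
      also have "\<dots> \<le> dist y z / (d / 2)" using tri zs d(1) by (intro frac_le) auto
      finally show ?thesis using a by (simp add: c_def abs_le_iff)
    qed
    note int = Bochner_Integration.integrable_diff[OF log_pot_integrable[of y] log_pot_integrable[of z]]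
    have "log_pot E y - log_pot E z = (LINT s|lborel. indicator E s * (ln (cmod (z - of_real s)) - ln (cmod (y - of_real s))))"
      unfolding log_pot_def using y z
      by (subst Bochner_Integration.integral_diff[symmetric, OF log_pot_integrable log_pot_integrable])
         (auto intro!: Bochner_Integration.integral_cong simp: right_diff_distrib)
    also have "\<bar>\<dots>\<bar> \<le> (LINT s|lborel. indicator E s * c)"
    proof (rule integral_abs_bound[THEN order_trans, OF Bochner_Integration.integral_mono])
      show "integrable lborel (\<lambda>s. \<bar>indicator E s * (ln (cmod (z - of_real s)) - ln (cmod (y - of_real s)))\<bar>)"
        using int y z by (intro integrable_abs) (simp add: algebra_simps)
      show "integrable lborel (\<lambda>s. indicator E s * c)" by (rule integrable_indicator_compact)
    qed (simp add: indicator_def ln_le)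
    also have "\<dots> = m * c" by (simp add: integral_indicator_compact m_def)
    also have "\<dots> \<le> (m + 1) * c" using d by (intro mult_right_mono) (auto simp: c_def)
    also have "\<dots> < (m + 1) * (e * d / (2 * (m + 1)) * (2 / d))"
      unfolding c_def using d y(2) \<open>m \<ge> 0\<close>
      by (intro mult_strict_left_mono mult_strict_right_mono) (auto simp: \<delta>_def)
    also have "\<dots> = e" using d \<open>m \<ge> 0\<close> by (simp add: field_simps)
    finally show ?thesis by (simp add: dist_real_def)
  qed
  ultimately show "\<exists>\<delta>>0. \<forall>y\<in>- ?C. dist y z < \<delta> \<longrightarrow> dist (log_pot E y) (log_pot E z) < e" by blast
qed

text \<open>Fubini reduces the mean value property of the potential to that of each \<open>ln |z - s|\<close>.\<close>
lemma log_pot_circle_mean: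
  assumes r: "0 < r" and disj: "cball z r \<inter> of_real ` E = {}"
  shows "((\<lambda>\<theta>. log_pot E (z + of_real r * cis \<theta>)) has_integral 2 * pi * log_pot E z) {0..2*pi}"
proof -
  define k where "k \<theta> s = indicator {0..2*pi} \<theta> * (indicator E s *
      (ln (3/4) - ln (cmod (z + of_real r * cis \<theta> - of_real s))))" for \<theta> s
  have ne: "z + of_real r * cis \<theta> \<noteq> of_real s" if "s \<in> E" for \<theta> s
  proof
    assume "z + of_real r * cis \<theta> = of_real s"
    moreover have "z + of_real r * cis \<theta> \<in> cball z r" using r by (simp add: dist_norm norm_mult)
    ultimately show False using disj that by auto
  qed
  have "integrable lborel (\<lambda>x. indicator ({0..2*pi} \<times> E) x *\<^sub>R
      (\<lambda>(\<theta>, s). ln (3/4) - ln (cmod (z + of_real r * cis \<theta> - of_real s))) x)"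
    unfolding case_prod_unfold using ne
    by (intro borel_integrable_compact compact_Times E compact_Icc continuous_intros) auto
  then have int: "integrable (lborel \<Otimes>\<^sub>M lborel) (\<lambda>(\<theta>, s). k \<theta> s)"
    unfolding lborel_prod k_def case_prod_unfold indicator_times by (simp add: mult.assoc)
  have 1: "(LINT s|lborel. k \<theta> s) = indicator {0..2*pi} \<theta> * log_pot E (z + of_real r * cis \<theta>)" for \<theta>
    by (simp add: k_def log_pot_def)
  have 2: "(LINT \<theta>|lborel. k \<theta> s) = 2 * pi * (indicator E s * (ln (3/4) - ln (cmod (z - of_real s))))" for s
  proof (cases "s \<in> E")
    case True
    have "of_real s \<notin> cball z r" using disj True by auto
    note m = has_integral_diff[OF has_integral_const_real[of "ln (3/4)" 0 "2*pi"] log_circle_mean[OF r this]]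
    have "integrable lborel (\<lambda>\<theta>. indicator {0..2*pi} \<theta> *\<^sub>R (ln (3/4) - ln (cmod (z + of_real r * cis \<theta> - of_real s))))"
      using ne[OF True] by (intro borel_integrable_compact compact_Icc continuous_intros) auto
    from has_integral_integral_lborel[OF this]
    have "((\<lambda>\<theta>. if \<theta> \<in> {0..2*pi} then ln (3/4) - ln (cmod (z + of_real r * cis \<theta> - of_real s)) else 0)
        has_integral (LINT \<theta>|lborel. k \<theta> s)) UNIV"
      using True by (auto simp: k_def elim!: has_integral_eq[rotated])
    then have "((\<lambda>\<theta>. ln (3/4) - ln (cmod (z + of_real r * cis \<theta> - of_real s))) has_integral (LINT \<theta>|lborel. k \<theta> s)) {0..2*pi}"
      unfolding has_integral_restrict_UNIV .
    from has_integral_unique[OF this m] show ?thesis using True by (simp add: algebra_simps)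
  qed (simp add: k_def)
  have "integrable lborel (\<lambda>\<theta>. LINT s|lborel. k \<theta> s)"
    using lborel_pair.integrable_fst[OF int] by simp
  from has_integral_integral_lborel[OF this]
  have "((\<lambda>\<theta>. if \<theta> \<in> {0..2*pi} then log_pot E (z + of_real r * cis \<theta>) else 0) has_integral
      (LINT \<theta>|lborel. LINT s|lborel. k \<theta> s)) UNIV"
    unfolding 1 by (auto elim!: has_integral_eq[rotated])
  then have "((\<lambda>\<theta>. log_pot E (z + of_real r * cis \<theta>)) has_integral (LINT \<theta>|lborel. LINT s|lborel. k \<theta> s)) {0..2*pi}"
    unfolding has_integral_restrict_UNIV .
  moreover have "(LINT \<theta>|lborel. LINT s|lborel. k \<theta> s) = (LINT s|lborel. LINT \<theta>|lborel. k \<theta> s)"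
    using lborel_pair.Fubini_integral[OF int] by simp
  ultimately show ?thesis unfolding 2 by (simp add: log_pot_def)
qed

text \<open>With \<open>m = |E|\<close> and \<open>a = |s - x|\<close>, the bound comes from
  \<open>ln (1/a) = 2 ln (1/m) + 2 ln (m / sqrt a)\<close>, in which the last logarithm is at most
  \<open>m / sqrt a\<close>. Integrated over \<open>E\<close> the first term gives \<open>2 m ln (1/m)\<close> and the second at
  most \<open>12 m\<close>. So the average of the kernel exceeds \<open>2 ln (1/m)\<close> by a bounded amount only.\<close>
lemma log_pot_le:
  assumes m: "0 < measure lborel E" and E01: "E \<subseteq> {0..1}"
    and z: "z \<in> cball 0 1" "z \<notin> of_real ` E"
  shows "log_pot E z \<le> measure lborel E * (2 * ln (1 / measure lborel E) + 12)"
proof -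
  define m where "m = measure lborel E"
  have "m > 0" using assms(1) by (simp add: m_def)
  define x where "x = Re z"
  have x: "\<bar>x\<bar> \<le> 1" using z(1) abs_Re_le_cmod[of z] by (auto simp: x_def)
  let ?f = "\<lambda>s. indicator {x-2..x+2} s * (1 / sqrt \<bar>s - x\<bar>)"
  have pt: "indicator E s * (ln (3/4) - ln (cmod (z - of_real s)))
      \<le> indicator E s * (2 * ln (1/m)) + 2 * m * ?f s" if "s \<noteq> x" for s
  proof (cases "s \<in> E")
    case True
    define a where "a = \<bar>s - x\<bar>"
    have "a > 0" using that by (simp add: a_def)
    have "a \<le> cmod (z - of_real s)"
      using abs_Re_le_cmod[of "z - of_real s"] by (simp add: a_def x_def abs_minus_commute)
    then have "ln a \<le> ln (cmod (z - of_real s))" using \<open>a > 0\<close> by (intro ln_mono)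
    moreover have "ln (3/4::real) \<le> 0" by (simp add: ln_le_zero_iff)
    moreover have "- ln a = 2 * ln (1/m) + 2 * ln (m / sqrt a)"
      using \<open>a > 0\<close> \<open>m > 0\<close> by (simp add: ln_div ln_sqrt)
    moreover have "ln (m / sqrt a) \<le> m / sqrt a - 1"
      using \<open>a > 0\<close> \<open>m > 0\<close> by (intro ln_le_minus_one) simp
    moreover have "s \<in> {x-2..x+2}" using True E01 x by (auto simp: subset_iff)
    ultimately have "ln (3/4) - ln (cmod (z - of_real s)) \<le> 2 * ln (1/m) + 2 * (m / sqrt a)" "?f s = 1 / sqrt a"
      by (linarith, simp add: a_def)
    then show ?thesis using True by simp
  qed (use \<open>m > 0\<close> in simp)
  have "log_pot E z \<le> (LINT s|lborel. indicator E s * (2 * ln (1/m)) + 2 * m * ?f s)"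
    unfolding log_pot_def
  proof (rule integral_mono_AE)
    show "AE s in lborel. indicator E s * (ln (3/4) - ln (cmod (z - of_real s)))
      \<le> indicator E s * (2 * ln (1/m)) + 2 * m * ?f s"
      using AE_lborel_singleton[of x] by eventually_elim (rule pt)
  qed (intro log_pot_integrable z Bochner_Integration.integrable_add integrable_indicator_compact
         integrable_mult_right inv_sqrt_kernel)+
  also have "\<dots> = (LINT s|lborel. indicator E s * (2 * ln (1/m))) + (LINT s|lborel. 2 * m * ?f s)"
    by (intro Bochner_Integration.integral_add integrable_indicator_compact integrable_mult_right inv_sqrt_kernel)
  also have "\<dots> = m * (2 * ln (1/m)) + 2 * m * (LINT s|lborel. ?f s)"
    by (simp only: integral_indicator_compact integral_mult_right_zero m_def)
  also have "\<dots> \<le> m * (2 * ln (1/m)) + 2 * m * 6"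
    using inv_sqrt_kernel(2)[of x] \<open>m > 0\<close> by (intro add_left_mono mult_left_mono) auto
  finally show ?thesis by (simp add: m_def algebra_simps)
qed

end

section \<open>Exponential decay of sublevel sets\<close>

text \<open>The maximum principle is applied to \<open>\<phi>\<close> plus the potential of \<open>E\<close>, scaled so that
  its upper bound becomes \<open>K t\<close>. The interval \<open>[1/8, 1/4]\<close> stays away from \<open>0\<close>, where \<open>\<phi>\<close> is bounded
  below, and from the unit circle, where the potential has to be nonpositive.\<close>
lemma disc_sublevel_compact:
  assumes sh: "subharmonic_disc \<phi>" and K: "K > 0" and t: "t \<ge> 0"
    and M: "\<And>z. z \<in> cball 0 1 \<Longrightarrow> \<phi> z \<le> ereal M"
    and 0: "\<phi> 0 \<ge> ereal (M - K)"
    and E: "compact E" "E \<subseteq> {1/8..1/4}"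
    and small: "\<And>s. s \<in> E \<Longrightarrow> \<phi> (of_real s) < ereal (M - K * t)"
  shows "measure lborel E \<le> exp (6 - t/2)"
proof (cases "measure lborel E > 0")
  case True
  define m where "m = measure lborel E"
  define C :: "complex set" where "C = of_real ` E"
  have "m > 0" using True by (simp add: m_def)
  have "m \<le> measure lborel {1/8..1/4::real}"
    unfolding m_def using E by (intro measure_mono_fmeasurable) (auto simp: borel_compact intro: fmeasurable_compact)
  then have "m \<le> 1" by simp
  define B where "B = 2 * ln (1/m) + 12"
  have "0 \<le> ln (1/m)" using \<open>m > 0\<close> \<open>m \<le> 1\<close> by (intro ln_ge_zero) simp
  then have "B > 0" by (simp add: B_def)
  define \<kappa> where "\<kappa> = K * t / (m * B)"
  have "\<kappa> \<ge> 0" using K t \<open>m > 0\<close> \<open>B > 0\<close> by (simp add: \<kappa>_def)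
  have C: "compact C" unfolding C_def
    using E(1) by (intro compact_continuous_image continuous_intros)
  have "\<phi> 0 + ereal (\<kappa> * log_pot E 0) \<le> ereal M"
  proof (rule disc_maximum_principle[OF sh C, where L = "K * t"])
    show "C \<subseteq> ball 0 1" using E(2) by (auto simp: C_def subset_iff)
    show "continuous_on (cball 0 1 - C) (\<lambda>z. \<kappa> * log_pot E z)"
      by (intro continuous_intros continuous_on_subset[OF log_pot_continuous[OF E(1)]]) (auto simp: C_def)
    show "((\<lambda>\<theta>. \<kappa> * log_pot E (z + of_real r * cis \<theta>)) has_integral 2 * pi * (\<kappa> * log_pot E z)) {0..2*pi}"
      if "0 < r" "cball z r \<subseteq> cball 0 1 - C" for z r
      using has_integral_mult_right[OF log_pot_circle_mean[OF E(1), of r z], of \<kappa>] that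
      by (auto simp: C_def mult_ac)
    show "\<kappa> * log_pot E z \<le> 0" if "cmod z = 1" for z
    proof -
      have "log_pot E z \<le> integral\<^sup>L lborel (\<lambda>s::real. 0)" unfolding log_pot_def
      proof (rule Bochner_Integration.integral_mono)
        show "integrable lborel (\<lambda>s. indicator E s * (ln (3/4) - ln (cmod (z - of_real s))))"
          using that E(2) by (intro log_pot_integrable E(1)) (auto simp: subset_iff)
        show "indicator E s * (ln (3/4) - ln (cmod (z - of_real s))) \<le> 0" for s
        proof (cases "s \<in> E")
          case True
          have "3/4 \<le> cmod (z - of_real s)"
            using norm_triangle_ineq2[of z "of_real s"] True E(2) that by (auto simp: subset_iff)
          then have "ln (3/4) \<le> ln (cmod (z - of_real s))" by (intro ln_mono) auto
          then show ?thesis using True by simp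
        qed simp
      qed simp
      then show ?thesis using \<open>\<kappa> \<ge> 0\<close> by (simp add: mult_nonneg_nonpos)
    qed
    show "\<kappa> * log_pot E z \<le> K * t" if "z \<in> cball 0 1 - C" for z
    proof -
      have "\<kappa> * log_pot E z \<le> \<kappa> * (m * B)"
        using log_pot_le[OF E(1), of z] True E(2) that \<open>\<kappa> \<ge> 0\<close>
        by (intro mult_left_mono) (force simp: m_def B_def C_def)+
      then show ?thesis using \<open>m > 0\<close> \<open>B > 0\<close> by (simp add: \<kappa>_def)
    qed
    show "0 \<in> cball 0 1 - C" using E(2) by (auto simp: C_def)
  qed (use M small in \<open>auto simp: C_def\<close>)
  then have "ereal (M - K) + ereal (\<kappa> * log_pot E 0) \<le> ereal M"
    using 0 by (meson add_right_mono order_trans)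
  then have le: "\<kappa> * log_pot E 0 \<le> K" by simp
  have "m = (LINT s|lborel. indicator E s * 1)"
    using integral_indicator_compact[OF E(1), of 1] by (simp add: m_def)
  also have "\<dots> \<le> log_pot E 0" unfolding log_pot_def
  proof (rule Bochner_Integration.integral_mono)
    show "integrable lborel (\<lambda>s. indicator E s * (ln (3/4) - ln (cmod (0 - of_real s))))"
      using E(2) by (intro log_pot_integrable E(1)) (auto simp: subset_iff)
    show "indicator E s * 1 \<le> indicator E s * (ln (3/4) - ln (cmod (0 - of_real s)))" for s
    proof (cases "s \<in> E")
      case True
      then have s: "1/8 \<le> s" "s \<le> 1/4" using E(2) by auto
      then have "ln s \<le> ln (1/4)" by simp
      moreover have "1 \<le> ln (3::real)" using exp_le by (simp add: ln_ge_iff)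
      moreover have "ln (3/4) = ln 3 + ln (1/4::real)" by (simp add: ln_div)
      ultimately have "1 \<le> ln (3/4) - ln s" by linarith
      then show ?thesis using s True by simp
    qed simp
  qed (intro integrable_indicator_compact E(1))
  finally have "\<kappa> * m \<le> K" using le \<open>\<kappa> \<ge> 0\<close> by (meson mult_left_mono order_trans)
  then have "t \<le> B" using \<open>m > 0\<close> \<open>B > 0\<close> K by (simp add: \<kappa>_def field_simps)
  then have "ln m \<le> 6 - t / 2" using \<open>m > 0\<close> by (simp add: B_def ln_div)
  then have "exp (ln m) \<le> exp (6 - t / 2)" by (subst exp_le_cancel_iff)
  then show ?thesis using \<open>m > 0\<close> by (simp only: exp_ln m_def)
next
  case False
  then show ?thesis by (meson exp_ge_zero not_less order_trans)
qed

text \<open>Borel sets are exhausted by compact ones from inside.\<close>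
lemma disc_sublevel:
  assumes sh: "subharmonic_disc \<phi>" and K: "K > 0" and t: "t \<ge> 0"
    and M: "\<And>z. z \<in> cball 0 1 \<Longrightarrow> \<phi> z \<le> ereal M"
    and 0: "\<phi> 0 \<ge> ereal (M - K)"
    and E: "E \<in> sets borel" "E \<subseteq> {1/8..1/4}"
    and small: "\<And>s. s \<in> E \<Longrightarrow> \<phi> (of_real s) < ereal (M - K * t)"
  shows "emeasure lborel E \<le> ennreal (exp (6 - t/2))"
proof (rule ennreal_le_epsilon)
  fix e :: real assume "e > 0"
  have "E \<in> sets lebesgue" using E(1) by simp
  then obtain T where T: "closed T" "T \<subseteq> E" "emeasure lebesgue (E - T) < ennreal e"
    using sets_lebesgue_inner_closed[OF _ \<open>e > 0\<close>] by metis
  have cT: "compact T"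
    using T(1,2) E(2) by (metis bounded_closed_interval bounded_subset compact_eq_bounded_closed)
  have "emeasure lborel E = emeasure lborel (T \<union> (E - T))" using T(2) by (simp add: Un_absorb1)
  also have "\<dots> \<le> emeasure lborel T + emeasure lborel (E - T)"
    using T(1) E(1) by (intro emeasure_subadditive) auto
  also have "emeasure lborel (E - T) \<le> ennreal e" using T(1,3) E(1) by simp
  also have "emeasure lborel T = ennreal (measure lborel T)"
    using emeasure_compact_finite[OF cT] by (simp add: emeasure_eq_ennreal_measure less_top)
  also have "\<dots> \<le> ennreal (exp (6 - t/2))"
    using disc_sublevel_compact[OF sh K t M 0 cT] T(2) E(2) small by (intro ennreal_leI) blast
  finally show "emeasure lborel E \<le> ennreal (exp (6 - t/2)) + ennreal e" by (simp add: add_mono)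
qed

section \<open>Local exponential integrability of plurisubharmonic functions\<close>
lemma norm_vector_scalar_mult: "norm (c *s (w :: complex^'n)) = cmod c * norm w"
proof -
  have "norm (c *s w) = sqrt ((cmod c)\<^sup>2 * (\<Sum>i\<in>UNIV. (cmod (w $ i))\<^sup>2))"
    by (simp add: norm_vec_def L2_set_def norm_mult power_mult_distrib sum_distrib_left)
  then show ?thesis by (simp add: norm_vec_def L2_set_def real_sqrt_mult)
qed

lemma of_real_scalar_mult: "complex_of_real s *s w = s *\<^sub>R (w :: complex^'n)"
  by (simp add: vec_eq_iff scaleR_conv_of_real[where 'a = complex])

lemma psh_usc:
  assumes "psh_on U u" "z \<in> U" "u z < t"
  shows "\<forall>\<^sub>F x in nhds z. u x < t"
  using assms unfolding psh_on_def by (simp add: eventually_nhds_conv_at)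

lemma subharmonic_disc_slice:
  fixes u :: "complex^'n \<Rightarrow> ereal"
  assumes psh: "psh_on U u" and disc: "\<And>\<zeta>. cmod \<zeta> \<le> 1 \<Longrightarrow> b + \<zeta> *s w \<in> U"
  shows "subharmonic_disc (\<lambda>\<zeta>. u (b + \<zeta> *s w))"
  unfolding subharmonic_disc_def
proof (intro conjI ballI allI impI)
  fix z :: complex assume z: "z \<in> cball 0 1"
  then show "u (b + z *s w) < \<infinity>" using psh disc[of z] by (simp add: psh_on_def)
  fix t assume "u (b + z *s w) < t"
  with z have "\<forall>\<^sub>F x in nhds (b + z *s w). u x < t" using psh_usc[OF psh] disc[of z] by simp
  moreover have "filterlim (\<lambda>\<zeta>. b + \<zeta> *s w) (nhds (b + z *s w)) (nhds z)"
    unfolding vector_scalar_mult_def by (intro tendsto_intros filterlim_ident)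
  ultimately show "\<forall>\<^sub>F x in nhds z. u (b + x *s w) < t"
    by (rule eventually_compose_filterlim)
next
  fix z :: complex and r :: real
  assume r: "0 < r" "cball z r \<subseteq> cball 0 1"
  have eq: "b + z *s w + \<zeta> *s (of_real r *s w) = b + (z + of_real r * \<zeta>) *s w" for \<zeta>
    by (simp add: vec_eq_iff algebra_simps)
  have "b + z *s w + \<zeta> *s (of_real r *s w) \<in> U" if "cmod \<zeta> \<le> 1" for \<zeta>
  proof -
    have "z + of_real r * \<zeta> \<in> cball z r" using r(1) that by (simp add: dist_norm norm_mult mult_left_le)
    then have "cmod (z + of_real r * \<zeta>) \<le> 1" using r(2) by auto
    then show ?thesis unfolding eq by (rule disc)
  qed
  then have "u (b + z *s w) \<le> ereal_integral (lebesgue_on {0..2*pi})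
      (\<lambda>\<theta>. u (b + z *s w + cis \<theta> *s (of_real r *s w))) / ereal (2*pi)"
    using psh unfolding psh_on_def by blast
  then show "u (b + z *s w) \<le> ereal_integral (lebesgue_on {0..2*pi})
      (\<lambda>\<theta>. u (b + (z + of_real r * cis \<theta>) *s w)) / ereal (2*pi)"
    unfolding eq .
qed

text \<open>Tonelli for the map \<open>(s, w) \<mapsto> b + s w\<close> with real \<open>s\<close> in \<open>[1/8, 1/4]\<close>. For fixed \<open>s\<close> the
  substitution \<open>y = b + s w\<close> changes the volume by \<open>s\<close> to the power of the dimension, which is at most
  \<open>1\<close>, and carries \<open>ball 0 R\<close> onto a ball that contains \<open>W\<close>. The factor \<open>8\<close> is the reciprocal of
  the length of the segment.\<close>
lemma emeasure_le_segment_slices: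
  fixes W :: "'a::euclidean_space set"
  assumes W: "open W" "W \<subseteq> ball b (R/8)"
    and slice: "\<And>w. w \<in> ball 0 R \<Longrightarrow> emeasure lborel {s \<in> {1/8..1/4}. b + s *\<^sub>R w \<in> W} \<le> C"
  shows "emeasure lborel W \<le> 8 * (C * emeasure lborel (ball (0::'a) R))"
proof -
  define Y where "Y = {(s, w). s \<in> {1/8..1/4::real} \<and> b + s *\<^sub>R w \<in> W}"
  have "open ((\<lambda>p. b + fst p *\<^sub>R snd p) -` W)"
    by (intro open_vimage W continuous_intros)
  then have Y1: "(\<lambda>p. b + fst p *\<^sub>R snd p) -` W \<in> sets borel" by simp
  have "closed ({1/8..1/4::real} \<times> (UNIV :: 'a set))" by (intro closed_Times) auto
  then have Y2: "{1/8..1/4::real} \<times> (UNIV :: 'a set) \<in> sets borel" by simp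
  have "Y = ({1/8..1/4::real} \<times> UNIV) \<inter> (\<lambda>p. b + fst p *\<^sub>R snd p) -` W"
    by (auto simp: Y_def)
  with Y1 Y2 have Yb: "Y \<in> sets (lborel \<Otimes>\<^sub>M lborel)"
    unfolding lborel_prod by simp
  have small: "w \<in> ball 0 R" if "s \<in> {1/8..1/4}" "b + s *\<^sub>R w \<in> W" for s w
  proof -
    have "s * norm w < R / 8" using that W(2) by (force simp: dist_norm)
    moreover have "1/8 * norm w \<le> s * norm w" using that by (intro mult_right_mono) auto
    ultimately show ?thesis by simp
  qed
  have 1: "indicator {1/8..1/4} s * emeasure lborel W \<le> (\<integral>\<^sup>+w. indicator Y (s, w) \<partial>lborel)" for s :: real
  proof (cases "s \<in> {1/8..1/4}")
    case True
    then have s: "0 < s" "s \<le> 1" by auto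
    have Wb [measurable]: "W \<in> sets borel" using W by simp
    then have "emeasure lborel W = (\<integral>\<^sup>+y. indicator W y \<partial>lborel)" by simp
    also have "\<dots> = (\<integral>\<^sup>+y. indicator W y \<partial>density (distr lborel borel (\<lambda>w. b + s *\<^sub>R w)) (\<lambda>_. \<bar>s\<bar>^DIM('a)))"
      using s by (subst lborel_affine[of s b]) auto
    also have "\<dots> = (\<integral>\<^sup>+y. ennreal (\<bar>s\<bar>^DIM('a)) * indicator W y \<partial>distr lborel borel (\<lambda>w. b + s *\<^sub>R w))"
      using Wb by (intro nn_integral_density) auto
    also have "\<dots> = (\<integral>\<^sup>+w. ennreal (\<bar>s\<bar>^DIM('a)) * indicator W (b + s *\<^sub>R w) \<partial>lborel)"
      using Wb by (intro nn_integral_distr) auto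
    also have "\<dots> = ennreal (\<bar>s\<bar>^DIM('a)) * (\<integral>\<^sup>+w. indicator W (b + s *\<^sub>R w) \<partial>lborel)"
      using Wb by (intro nn_integral_cmult) measurable
    also have "\<dots> \<le> 1 * (\<integral>\<^sup>+w. indicator W (b + s *\<^sub>R w) \<partial>lborel)"
      using s by (intro mult_right_mono) (auto simp: power_le_one)
    also have "\<dots> = (\<integral>\<^sup>+w. indicator Y (s, w) \<partial>lborel)"
      using True by (auto simp: Y_def indicator_def intro!: nn_integral_cong)
    finally show ?thesis using True by simp
  qed simp
  have 2: "(\<integral>\<^sup>+s. indicator Y (s, w) \<partial>lborel) \<le> C * indicator (ball 0 R) w" for w
  proof (cases "w \<in> ball 0 R")
    case True
    have "{s \<in> {1/8..1/4}. b + s *\<^sub>R w \<in> W} = {1/8..1/4} \<inter> (\<lambda>s. b + s *\<^sub>R w) -` W" by auto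
    moreover have "open ((\<lambda>s. b + s *\<^sub>R w) -` W)" by (intro open_vimage W continuous_intros)
    ultimately have "{s \<in> {1/8..1/4}. b + s *\<^sub>R w \<in> W} \<in> sets borel" by simp
    moreover have "(\<integral>\<^sup>+s. indicator Y (s, w) \<partial>lborel) = (\<integral>\<^sup>+s. indicator {s \<in> {1/8..1/4}. b + s *\<^sub>R w \<in> W} s \<partial>lborel)"
      by (auto simp: Y_def indicator_def intro!: nn_integral_cong)
    ultimately show ?thesis using slice[OF True] True by simp
  next
    case False
    then have "indicator Y (s, w) = (0::ennreal)" for s
      using small[of s w] by (auto simp: Y_def indicator_def)
    then show ?thesis by simp
  qed
  have "ennreal (1/8) * emeasure lborel W = (\<integral>\<^sup>+s. indicator {1/8..1/4::real} s * emeasure lborel W \<partial>lborel)"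
    by (subst nn_integral_multc) auto
  also have "\<dots> \<le> (\<integral>\<^sup>+s. \<integral>\<^sup>+w. indicator Y (s, w) \<partial>lborel \<partial>lborel)" by (intro nn_integral_mono 1)
  also have "\<dots> = (\<integral>\<^sup>+w. \<integral>\<^sup>+s. indicator Y (s, w) \<partial>lborel \<partial>lborel)"
    using Yb by (intro lborel_pair.Fubini[symmetric]) simp
  also have "\<dots> \<le> (\<integral>\<^sup>+w. C * indicator (ball (0::'a) R) w \<partial>lborel)" by (intro nn_integral_mono 2)
  also have "\<dots> = C * emeasure lborel (ball (0::'a) R)" by (rule nn_integral_cmult_indicator) simp
  finally have "8 * (ennreal (1/8) * emeasure lborel W) \<le> 8 * (C * emeasure lborel (ball (0::'a) R))"
    by (rule mult_left_mono) simp
  moreover have "8 * ennreal (1/8) = 1"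
    by (metis ennreal_1 ennreal_mult' ennreal_numeral nonzero_mult_div_cancel_left times_divide_eq_right mult.right_neutral zero_neq_numeral zero_le_numeral)
  ultimately show ?thesis by (simp add: mult.assoc[symmetric])
qed

lemma psh_sublevel:
  fixes u :: "complex^'n \<Rightarrow> ereal"
  assumes psh: "psh_on U u" and R: "R > 0" "cball b R \<subseteq> U"
    and M: "\<And>z. z \<in> cball b R \<Longrightarrow> u z < ereal M"
    and K: "K > 0" "u b \<ge> ereal (M - K)" and t: "t \<ge> 0"
  defines "W \<equiv> {y \<in> ball b (R/8). u y < ereal (M - K * t)}"
  shows "open W"
    and "emeasure lborel W \<le> 8 * (ennreal (exp (6 - t/2)) * emeasure lborel (ball (0::complex^'n) R))"
proof -
  show "open W"
  proof (subst open_subopen, intro ballI)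
    fix y assume y: "y \<in> W"
    then have "y \<in> cball b R" using R(1) by (auto simp: W_def)
    then have "y \<in> U" using R(2) by blast
    then have "\<forall>\<^sub>F x in nhds y. u x < ereal (M - K * t)"
      using psh_usc[OF psh] y by (simp add: W_def)
    then obtain S where S: "open S" "y \<in> S" "\<And>x. x \<in> S \<Longrightarrow> u x < ereal (M - K * t)"
      by (auto simp: eventually_nhds)
    then show "\<exists>T. open T \<and> y \<in> T \<and> T \<subseteq> W"
      using y by (intro exI[of _ "S \<inter> ball b (R/8)"]) (auto simp: W_def)
  qed
  show "emeasure lborel W \<le> 8 * (ennreal (exp (6 - t/2)) * emeasure lborel (ball (0::complex^'n) R))"
  proof (rule emeasure_le_segment_slices[OF \<open>open W\<close>])
    fix w :: "complex^'n" assume w: "w \<in> ball 0 R"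
    have in_cball: "b + \<zeta> *s w \<in> cball b R" if "cmod \<zeta> \<le> 1" for \<zeta>
    proof -
      have "cmod \<zeta> * norm w \<le> 1 * norm w" using that by (intro mult_right_mono) auto
      then show ?thesis using w by (simp add: dist_norm norm_vector_scalar_mult)
    qed
    let ?E = "{s \<in> {1/8..1/4}. b + s *\<^sub>R w \<in> W}"
    have "?E = {1/8..1/4} \<inter> (\<lambda>s. b + s *\<^sub>R w) -` W" by auto
    moreover have "open ((\<lambda>s. b + s *\<^sub>R w) -` W)" by (intro open_vimage \<open>open W\<close> continuous_intros)
    ultimately have E: "?E \<in> sets borel" by simp
    have "b + \<zeta> *s w \<in> U" if "cmod \<zeta> \<le> 1" for \<zeta> using in_cball[OF that] R(2) by blast
    then have sh: "subharmonic_disc (\<lambda>\<zeta>. u (b + \<zeta> *s w))" by (rule subharmonic_disc_slice[OF psh])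
    show "emeasure lborel ?E \<le> ennreal (exp (6 - t/2))"
    proof (rule disc_sublevel[OF sh K(1) t _ _ E])
      show "u (b + z *s w) \<le> ereal M" if "z \<in> cball 0 1" for z
        using M[OF in_cball[of z]] that by simp
      show "ereal (M - K) \<le> u (b + 0 *s w)" using K(2) by simp
      show "?E \<subseteq> {1/8..1/4}" by blast
      show "u (b + of_real s *s w) < ereal (M - K * t)" if "s \<in> ?E" for s
        using that by (simp only: of_real_scalar_mult W_def mem_Collect_eq)
    qed
  qed (use W_def in blast)
qed

text \<open>A layer cake bound. If \<open>v\<close> is finite, the level \<open>k\<close> with
  \<open>M - K (k + 1) \<le> v < M - K k\<close> suffices; if \<open>v = -\<infinity>\<close>, all levels
  contribute at least the same positive constant and the series diverges.\<close>
lemma exp_ereal_neg_le_suminf: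
  fixes v :: ereal
  assumes v: "v < ereal M" and K: "K > 0" and c: "c > 0"
  shows "exp_ereal (- (2 * (ereal c * v))) \<le>
    (\<Sum>k. ennreal (exp (2 * c * (K * (real k + 1) - M))) * indicator {x. x < ereal (M - K * real k)} v)"
    (is "_ \<le> suminf ?f")
proof (cases v)
  case (real r)
  define x where "x = (M - r) / K"
  have "x > 0" using v K real by (simp add: x_def)
  define k where "k = nat (\<lceil>x\<rceil> - 1)"
  have "real k = real_of_int \<lceil>x\<rceil> - 1" using \<open>x > 0\<close> unfolding k_def by (subst of_nat_nat) auto
  then have k: "real k < x" "x \<le> real k + 1" by linarith+
  have r: "r = M - K * x" using K by (simp add: x_def)
  have "K * real k < K * x" "K * x \<le> K * (real k + 1)" using k K by auto
  then have k': "r < M - K * real k" "- r \<le> K * (real k + 1) - M" by (auto simp: r)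
  have "exp_ereal (- (2 * (ereal c * v))) = ennreal (exp (2 * c * (- r)))"
    by (simp add: real exp_ereal_def)
  also have "\<dots> \<le> ennreal (exp (2 * c * (K * (real k + 1) - M)))"
    using k'(2) c by (intro ennreal_leI iffD2[OF exp_le_cancel_iff] mult_left_mono) auto
  also have "\<dots> = sum ?f {k}" using k'(1) by (simp add: real)
  also have "\<dots> \<le> suminf ?f" by (intro sum_le_suminf) auto
  finally show ?thesis .
next
  case MInf
  have "\<infinity> = (\<integral>\<^sup>+k. ennreal (exp (2 * c * (- M))) \<partial>count_space (UNIV :: nat set))"
    by (simp add: ennreal_mult_top)
  also have "\<dots> = (\<Sum>k::nat. ennreal (exp (2 * c * (- M))))" by (rule nn_integral_count_space_nat)
  also have "\<dots> \<le> suminf ?f"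
  proof (intro suminf_le)
    fix k :: nat
    have "2 * c * (- M) \<le> 2 * c * (K * (real k + 1) - M)"
      using c K by (intro mult_left_mono) auto
    then show "ennreal (exp (2 * c * (- M))) \<le> ?f k" by (simp add: MInf ennreal_leI)
  qed auto
  finally show ?thesis by (simp add: top_unique)
qed (use v in simp)

text \<open>The exponent \<open>c = 1 / (8 K)\<close> makes the weight of the level \<open>k\<close> grow like \<open>e\<^sup>k\<^sup>/\<^sup>4\<close>, while its
  volume decays like \<open>e\<^sup>-\<^sup>k\<^sup>/\<^sup>2\<close>. The radius \<open>R / 8\<close> is independent of the value at \<open>b\<close>, so
  that \<open>b\<close> can be moved to a neighbouring point at which \<open>u\<close> is finite.\<close>
lemma psh_exp_integrable_ball:
  fixes u :: "complex^'n \<Rightarrow> ereal"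
  assumes psh: "psh_on U u" and R: "R > 0" "cball b R \<subseteq> U"
    and M: "\<And>z. z \<in> cball b R \<Longrightarrow> u z < ereal M" and b: "u b \<noteq> -\<infinity>"
  obtains c where "c > 0" "(\<integral>\<^sup>+z\<in>ball b (R/8). exp_ereal (- (2 * (ereal c * u z))) \<partial>lborel) < \<infinity>"
proof -
  have "u b < ereal M" using M[of b] R(1) by simp
  then obtain v where v: "u b = ereal v" "v < M" using b by (cases "u b") auto
  define K where "K = M - v"
  have K: "K > 0" "u b \<ge> ereal (M - K)" using v by (auto simp: K_def)
  define c where "c = 1 / (8 * K)"
  have "c > 0" using K by (simp add: c_def)
  define B where "B = measure lborel (ball (0::complex^'n) R)"
  have B: "emeasure lborel (ball (0::complex^'n) R) = ennreal B"
    using emeasure_lborel_ball_finite[of "0::complex^'n" R]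
    unfolding B_def by (intro emeasure_eq_ennreal_measure) auto
  have "B \<ge> 0" by (simp add: B_def)
  define W where "W k = {y \<in> ball b (R/8). u y < ereal (M - K * real k)}" for k
  have W: "open (W k)"
      "emeasure lborel (W k) \<le> 8 * (ennreal (exp (6 - real k / 2)) * emeasure lborel (ball (0::complex^'n) R))" for k
    unfolding W_def using psh_sublevel[OF psh R M K, of "real k"] by auto
  define e where "e k = exp (2 * c * (K * (real k + 1) - M))" for k
  have geom: "e k * (8 * (exp (6 - real k / 2) * B)) = 8 * B * exp (25/4 - 2 * c * M) * exp (- 1/4) ^ k" for k
  proof -
    have "2 * c * (K * (real k + 1) - M) = (real k + 1) / 4 - 2 * c * M"
      using K by (simp add: c_def field_simps)
    then have "e k * exp (6 - real k / 2) = exp (25/4 - 2 * c * M + real k * (- 1/4))"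
      unfolding e_def exp_add[symmetric] by (simp add: field_simps)
    also have "\<dots> = exp (25/4 - 2 * c * M) * exp (- 1/4) ^ k"
      by (simp only: exp_add exp_of_nat_mult)
    finally show ?thesis by simp
  qed
  have "(\<integral>\<^sup>+z\<in>ball b (R/8). exp_ereal (- (2 * (ereal c * u z))) \<partial>lborel)
      \<le> (\<integral>\<^sup>+z. (\<Sum>k. ennreal (e k) * indicator (W k) z) \<partial>lborel)"
  proof (rule nn_integral_mono)
    fix z
    show "exp_ereal (- (2 * (ereal c * u z))) * indicator (ball b (R/8)) z
      \<le> (\<Sum>k. ennreal (e k) * indicator (W k) z)"
    proof (cases "z \<in> ball b (R/8)")
      case True
      then have "u z < ereal M" using R(1) by (intro M) auto
      from exp_ereal_neg_le_suminf[OF this K(1) \<open>c > 0\<close>] show ?thesis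
        using True by (simp add: e_def W_def indicator_def)
    qed simp
  qed
  also have "\<dots> = (\<Sum>k. ennreal (e k) * emeasure lborel (W k))"
    using W(1) by (simp add: nn_integral_suminf nn_integral_cmult)
  also have "\<dots> \<le> (\<Sum>k. ennreal (8 * B * exp (25/4 - 2 * c * M) * exp (- 1/4) ^ k))"
  proof (intro suminf_le)
    fix k
    have "ennreal (e k) * emeasure lborel (W k) \<le> ennreal (e k) * (8 * (ennreal (exp (6 - real k / 2)) * ennreal B))"
      using W(2)[of k] by (intro mult_left_mono) (auto simp: B)
    also have "\<dots> = ennreal (e k * (8 * (exp (6 - real k / 2) * B)))"
      using \<open>B \<ge> 0\<close> by (simp add: ennreal_mult e_def)
    finally show "ennreal (e k) * emeasure lborel (W k)
        \<le> ennreal (8 * B * exp (25/4 - 2 * c * M) * exp (- 1/4) ^ k)" unfolding geom .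
  qed auto
  also have "\<dots> = ennreal (\<Sum>k. 8 * B * exp (25/4 - 2 * c * M) * exp (- 1/4) ^ k)"
    using \<open>B \<ge> 0\<close> by (intro suminf_ennreal2 summable_mult summable_geometric) auto
  also have "\<dots> < \<infinity>" by simp
  finally show ?thesis using that \<open>c > 0\<close> by blast
qed

definition exp_integrable_at :: "(complex^'n \<Rightarrow> ereal) \<Rightarrow> complex^'n \<Rightarrow> bool" where
  "exp_integrable_at u z \<longleftrightarrow> (\<exists>c>0. \<exists>V. open V \<and> z \<in> V \<and>
     (\<integral>\<^sup>+y\<in>V. exp_ereal (- (2 * (ereal c * u y))) \<partial>lborel) < \<infinity>)"

text \<open>On some ball of radius \<open>R\<close> around \<open>z\<close> the function is bounded above. For a point \<open>b\<close> with
  finite value within \<open>R / 16\<close> of \<open>z\<close>, the ball of radius \<open>R / 2\<close> around \<open>b\<close> lies in that ball, and its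
  concentric ball of one eighth the radius still contains \<open>z\<close>.\<close>
lemma exp_integrable_near_finite_value:
  fixes u :: "complex^'n \<Rightarrow> ereal"
  assumes psh: "psh_on U u" and z: "z \<in> U"
    and freq: "\<And>\<epsilon>. \<epsilon> > 0 \<Longrightarrow> \<exists>y\<in>ball z \<epsilon>. u y \<noteq> -\<infinity>"
  shows "exp_integrable_at u z"
proof -
  have "u z < \<infinity>" using psh z by (simp add: psh_on_def)
  then obtain M where M: "u z < ereal M" using ereal_dense2 by blast
  have "\<forall>\<^sub>F x in nhds z. u x < ereal M" by (rule psh_usc[OF psh z M])
  then obtain S where S: "open S" "z \<in> S" "\<And>x. x \<in> S \<Longrightarrow> u x < ereal M"
    by (auto simp: eventually_nhds)
  have "open (U \<inter> S)" using psh S by (auto simp: psh_on_def)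
  then obtain R where R: "R > 0" "cball z R \<subseteq> U \<inter> S"
    using z S(2) open_contains_cball_eq by blast
  obtain b where b: "dist z b < R / 16" "u b \<noteq> -\<infinity>" using freq[of "R/16"] R(1) by auto
  have sub: "cball b (R/2) \<subseteq> cball z R"
    
  proof
    fix x assume "x \<in> cball b (R/2)"
    moreover have "dist z x \<le> dist z b + dist b x" by (rule dist_triangle)
    ultimately show "x \<in> cball z R" using b(1) R(1) by simp
  qed
  have "\<And>y. y \<in> cball b (R/2) \<Longrightarrow> u y < ereal M" "cball b (R/2) \<subseteq> U" using sub R(2) S(3) by blast+
  then obtain c where c: "c > 0" "(\<integral>\<^sup>+z\<in>ball b (R/2/8). exp_ereal (- (2 * (ereal c * u z))) \<partial>lborel) < \<infinity>"
    using psh_exp_integrable_ball[OF psh, of "R/2" b M] R(1) b(2) by auto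
  then show ?thesis unfolding exp_integrable_at_def
    using b(1) by (intro exI[of _ c] conjI exI[of _ "ball b (R/2/8)"]) (auto simp: dist_commute)
qed

lemma exp_integrable_at_not_locally_minf:
  fixes u :: "complex^'n \<Rightarrow> ereal"
  assumes "exp_integrable_at u z" "open W" "z \<in> W"
  shows "\<exists>y\<in>W. u y \<noteq> -\<infinity>"
proof (rule ccontr)
  assume neg: "\<not> ?thesis"
  obtain c V where c: "c > 0" and V: "open V" "z \<in> V"
      "(\<integral>\<^sup>+y\<in>V. exp_ereal (- (2 * (ereal c * u y))) \<partial>lborel) < \<infinity>"
    using assms(1) unfolding exp_integrable_at_def by blast
  have "open (V \<inter> W)" "z \<in> V \<inter> W" using V assms by auto
  then obtain r where r: "r > 0" "ball z r \<subseteq> V \<inter> W" using open_contains_ball by blast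
  have "measure lborel (ball z r) > 0" using r(1) by (simp add: content_ball_pos)
  then have "emeasure lborel (ball z r) \<noteq> 0" by (auto simp: measure_def)
  then have "\<infinity> = (\<integral>\<^sup>+y. \<infinity> * indicator (ball z r) y \<partial>lborel)"
    by (subst nn_integral_cmult_indicator) (auto simp: ennreal_top_mult)
  also have "\<dots> \<le> (\<integral>\<^sup>+y\<in>V. exp_ereal (- (2 * (ereal c * u y))) \<partial>lborel)"
    using neg r(2) c by (intro nn_integral_mono) (auto simp: indicator_def exp_ereal_def)
  finally show False using V(3) by simp
qed

text \<open>The points near which \<open>u\<close> is exponentially integrable and those near which \<open>u\<close> is
  identically \<open>-\<infinity>\<close> form two disjoint open sets that cover the connected set \<open>U\<close>.\<close>
lemma psh_exp_integrable:
  fixes u :: "complex^'n \<Rightarrow> ereal"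
  assumes psh: "psh_on U u" and z: "z \<in> U"
  shows "exp_integrable_at u z"
proof -
  define A where "A = {z \<in> U. exp_integrable_at u z}"
  define N where "N = {z \<in> U. \<exists>\<epsilon>>0. \<forall>y\<in>ball z \<epsilon>. u y = -\<infinity>}"
  have U: "open U" "connected U" and "\<exists>z\<in>U. u z \<noteq> -\<infinity>" using psh by (auto simp: psh_on_def)
  then obtain a where a: "a \<in> U" "u a \<noteq> -\<infinity>" by blast
  have "open A"
  proof (subst open_subopen, intro ballI)
    fix z assume "z \<in> A"
    then obtain c V where V: "z \<in> U" "c > 0" "open V" "z \<in> V"
      "(\<integral>\<^sup>+y\<in>V. exp_ereal (- (2 * (ereal c * u y))) \<partial>lborel) < \<infinity>"
      unfolding A_def exp_integrable_at_def by blast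
    have "exp_integrable_at u y" if "y \<in> V" for y
      unfolding exp_integrable_at_def using V that by (intro exI[of _ c] conjI exI[of _ V])
    then have "U \<inter> V \<subseteq> A" by (auto simp: A_def)
    then show "\<exists>T. open T \<and> z \<in> T \<and> T \<subseteq> A" using U V by (intro exI[of _ "U \<inter> V"]) auto
  qed
  moreover have "open N"
  proof (subst open_subopen, intro ballI)
    fix z assume "z \<in> N"
    then obtain \<epsilon> where e: "z \<in> U" "\<epsilon> > 0" "\<forall>y\<in>ball z \<epsilon>. u y = -\<infinity>" by (auto simp: N_def)
    have "U \<inter> ball z \<epsilon> \<subseteq> N"
    proof
      fix x assume x: "x \<in> U \<inter> ball z \<epsilon>"
      then obtain d where "d > 0" "ball x d \<subseteq> ball z \<epsilon>" using openE[OF open_ball, of x z \<epsilon>] by blast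
      then show "x \<in> N" using x e by (auto simp: N_def)
    qed
    then show "\<exists>T. open T \<and> z \<in> T \<and> T \<subseteq> N" using U e by (intro exI[of _ "U \<inter> ball z \<epsilon>"]) auto
  qed
  moreover have "A \<inter> N \<inter> U = {}"
  proof -
    have False if z: "z \<in> A" "z \<in> N" for z
    proof -
      obtain \<epsilon> where "\<epsilon> > 0" "\<forall>y\<in>ball z \<epsilon>. u y = -\<infinity>" using z(2) by (auto simp: N_def)
      then show False
        using exp_integrable_at_not_locally_minf[of u z "ball z \<epsilon>"] z(1) by (auto simp: A_def)
    qed
    then show ?thesis by blast
  qed
  moreover have "U \<subseteq> A \<union> N"
  proof
    fix z assume "z \<in> U"
    show "z \<in> A \<union> N"
    proof (cases "z \<in> N")
      case False
      then have "\<exists>y\<in>ball z \<epsilon>. u y \<noteq> -\<infinity>" if "\<epsilon> > 0" for \<epsilon>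
        using \<open>z \<in> U\<close> that unfolding N_def by blast
      then show ?thesis
        using exp_integrable_near_finite_value[OF psh \<open>z \<in> U\<close>] \<open>z \<in> U\<close> by (simp add: A_def)
    qed simp
  qed
  ultimately have "A \<inter> U = {} \<or> N \<inter> U = {}" by (intro connectedD[OF U(2)])
  moreover have "a \<notin> N" using a centre_in_ball unfolding N_def by blast
  ultimately have "N \<inter> U = {}" using a(1) \<open>U \<subseteq> A \<union> N\<close> by blast
  then show ?thesis using z \<open>U \<subseteq> A \<union> N\<close> by (auto simp: A_def)
qed

section \<open>Interpolation of weights\<close>
definition integrable_near0 :: "('a::euclidean_space \<Rightarrow> ennreal) \<Rightarrow> bool" where
  "integrable_near0 h \<longleftrightarrow> (\<exists>V. open V \<and> 0 \<in> V \<and> (\<integral>\<^sup>+z\<in>V. h z \<partial>lborel) < \<infinity>)"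

lemma sq_integrable_near0_iff:
  "sq_integrable_near0 f u \<longleftrightarrow> integrable_near0 (\<lambda>z. ennreal ((norm (f z))\<^sup>2) * exp_ereal (- (2 * u z)))"
  by (simp add: sq_integrable_near0_def integrable_near0_def)

lemma integrable_near0_mono:
  assumes "integrable_near0 k" "open W" "0 \<in> W" "\<And>z. z \<in> W \<Longrightarrow> h z \<le> k z"
  shows "integrable_near0 h"
proof -
  obtain V where V: "open V" "0 \<in> V" "(\<integral>\<^sup>+z\<in>V. k z \<partial>lborel) < \<infinity>"
    using assms(1) by (auto simp: integrable_near0_def)
  have "(\<integral>\<^sup>+z\<in>V \<inter> W. h z \<partial>lborel) \<le> (\<integral>\<^sup>+z\<in>V. k z \<partial>lborel)"
    using assms(4) by (intro nn_integral_mono) (auto simp: indicator_def)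
  then show ?thesis using V assms(2,3) unfolding integrable_near0_def
    by (intro exI[of _ "V \<inter> W"]) auto
qed

lemma borel_measurable_on_open:
  fixes h :: "'a::topological_space \<Rightarrow> ennreal"
  assumes "h \<in> borel_measurable (restrict_space borel W)" "open W" "open V" "V \<subseteq> W"
  shows "(\<lambda>z. h z * indicator V z) \<in> borel_measurable borel"
proof -
  have "h \<in> borel_measurable (restrict_space borel V)"
    using assms(1,4) by (rule measurable_restrict_mono)
  then show ?thesis using assms(3) by (subst (asm) borel_measurable_restrict_space_iff_ennreal) auto
qed

lemma integrable_near0_add:
  assumes W: "open W" "0 \<in> W"
    and "h \<in> borel_measurable (restrict_space borel W)" "k \<in> borel_measurable (restrict_space borel W)"
    and "integrable_near0 h" "integrable_near0 k"
  shows "integrable_near0 (\<lambda>z. h z + k z)"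
proof -
  obtain A B where A: "open A" "0 \<in> A" "(\<integral>\<^sup>+z\<in>A. h z \<partial>lborel) < \<infinity>"
    and B: "open B" "0 \<in> B" "(\<integral>\<^sup>+z\<in>B. k z \<partial>lborel) < \<infinity>"
    using assms(5,6) by (auto simp: integrable_near0_def)
  let ?V = "W \<inter> (A \<inter> B)"
  have V: "open ?V" "0 \<in> ?V" "?V \<subseteq> W" using W A B by auto
  have "(\<integral>\<^sup>+z\<in>?V. (h z + k z) \<partial>lborel) = (\<integral>\<^sup>+z\<in>?V. h z \<partial>lborel) + (\<integral>\<^sup>+z\<in>?V. k z \<partial>lborel)"
    using borel_measurable_on_open[OF assms(3) W(1) V(1,3)] borel_measurable_on_open[OF assms(4) W(1) V(1,3)]
    by (subst nn_integral_add[symmetric]) (auto simp: distrib_right)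
  also have "\<dots> \<le> (\<integral>\<^sup>+z\<in>A. h z \<partial>lborel) + (\<integral>\<^sup>+z\<in>B. k z \<partial>lborel)"
    by (intro add_mono nn_integral_mono) (auto simp: indicator_def)
  also have "\<dots> < \<infinity>" using A B by simp
  finally show ?thesis unfolding integrable_near0_def using V by blast
qed

lemma integrable_near0_cmult:
  assumes W: "open W" "0 \<in> W" and h: "h \<in> borel_measurable (restrict_space borel W)"
    and "integrable_near0 h" and c: "c < \<infinity>"
  shows "integrable_near0 (\<lambda>z. c * h z)"
proof -
  obtain A where A: "open A" "0 \<in> A" "(\<integral>\<^sup>+z\<in>A. h z \<partial>lborel) < \<infinity>"
    using assms(4) by (auto simp: integrable_near0_def)
  have V: "open (W \<inter> A)" "0 \<in> W \<inter> A" "W \<inter> A \<subseteq> W" using W A by auto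
  have "(\<integral>\<^sup>+z\<in>W \<inter> A. c * h z \<partial>lborel) = c * (\<integral>\<^sup>+z\<in>W \<inter> A. h z \<partial>lborel)"
    using borel_measurable_on_open[OF h W(1) V(1,3)]
    by (subst nn_integral_cmult[symmetric]) (auto simp: mult.assoc)
  also have "\<dots> \<le> c * (\<integral>\<^sup>+z\<in>A. h z \<partial>lborel)"
    by (intro mult_left_mono nn_integral_mono) (auto simp: indicator_def)
  also have "\<dots> < \<infinity>" using A c by (simp add: ennreal_mult_less_top)
  finally show ?thesis unfolding integrable_near0_def using V by blast
qed

lemma borel_measurable_exp_ereal [measurable]: "exp_ereal \<in> borel_measurable borel"
proof -
  have eq: "exp_ereal = (\<lambda>x. if x = \<infinity> then \<infinity> else if x = -\<infinity> then 0 else ennreal (exp (real_of_ereal x)))"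
  proof
    fix x show "exp_ereal x = (if x = \<infinity> then \<infinity> else if x = -\<infinity> then 0 else ennreal (exp (real_of_ereal x)))"
      by (cases x) (auto simp: exp_ereal_def)
  qed
  show ?thesis unfolding eq by measurable
qed

lemma borel_measurable_ln_ereal [measurable]: "ln_ereal \<in> borel_measurable borel"
  unfolding ln_ereal_def[abs_def] by measurable

lemma psh_borel_measurable:
  assumes psh: "psh_on U u" and W: "open W" "W \<subseteq> U"
  shows "u \<in> borel_measurable (restrict_space borel W)"
proof (rule borel_measurableI_less)
  fix y
  have "open {z \<in> W. u z < y}"
  proof (subst open_subopen, intro ballI)
    fix z assume z: "z \<in> {z \<in> W. u z < y}"
    then have "\<forall>\<^sub>F x in nhds z. u x < y" using psh_usc[OF psh] W by blast
    then obtain S where "open S" "z \<in> S" "\<And>x. x \<in> S \<Longrightarrow> u x < y" by (auto simp: eventually_nhds)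
    then show "\<exists>T. open T \<and> z \<in> T \<and> T \<subseteq> {z \<in> W. u z < y}"
      using W z by (intro exI[of _ "S \<inter> W"]) auto
  qed
  then show "{z \<in> space (restrict_space borel W). u z < y} \<in> sets (restrict_space borel W)"
    using W by (auto simp: sets_restrict_space space_restrict_space image_iff intro!: bexI[of _ "{z \<in> W. u z < y}"])
qed

lemma holo_on_continuous: "holo_on f U \<Longrightarrow> continuous_on U f"
  unfolding holo_on_def by (meson continuous_at_imp_continuous_on has_derivative_continuous)

lemma holo_near0_common_list:
  fixes fs :: "(complex^'n \<Rightarrow> complex) list"
  assumes "\<And>f. f \<in> set fs \<Longrightarrow> holo_near0 f"
  obtains W where "open W" "0 \<in> W" "\<And>f. f \<in> set fs \<Longrightarrow> continuous_on W f"
proof -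
  have "\<exists>W. open W \<and> 0 \<in> W \<and> (\<forall>f\<in>set fs. continuous_on W f)"
    using assms
  proof (induction fs)
    case Nil
    then show ?case by (intro exI[of _ UNIV]) auto
  next
    case (Cons f fs)
    then obtain W where W: "open W" "0 \<in> W" "\<forall>f\<in>set fs. continuous_on W f" by auto
    obtain V where "0 \<in> V" "holo_on f V" using Cons.prems by (auto simp: holo_near0_def)
    then have "open V" "0 \<in> V" "continuous_on V f" using holo_on_continuous by (auto simp: holo_on_def)
    then show ?case using W
      by (intro exI[of _ "V \<inter> W"]) (auto intro: continuous_on_subset)
  qed
  then show ?thesis using that by blast
qed

text \<open>The heart of the interpolation. For \<open>L = ln G\<close> and \<open>b = c v / (1 + d)\<close> the exponent
  on the left is \<open>-2 d b\<close>, and those on the right are \<open>-2 d b + 2 (L - b)\<close> and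
  \<open>-2 d b - 2 d (L - b)\<close>; one of these is at least the left one, depending on the sign of
  \<open>L - b\<close>.\<close>
lemma young_weights:
  fixes v :: ereal
  assumes G: "0 \<le> G" and d: "0 < d" and c: "0 < c" and v: "v < \<infinity>"
  shows "exp_ereal (- (2 * (ereal (d * c / (1 + d)) * v)))
    \<le> ennreal (G\<^sup>2) * exp_ereal (- (2 * (ereal c * v))) + exp_ereal (- (2 * (ereal d * ln_ereal G)))"
proof (cases "G = 0")
  case True
  then show ?thesis using d by (simp add: ln_ereal_def exp_ereal_def)
next
  case False
  with G have "G > 0" by simp
  show ?thesis
  proof (cases v)
    case (real r)
    define L where "L = ln G"
    define b where "b = c * r / (1 + d)"
    have "c * r = (1 + d) * b" using d by (simp add: b_def)
    then have b: "c * r = b + d * b" by (simp add: distrib_right)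
    have eq: "d * c / (1 + d) * r = d * b" by (simp add: b_def)
    have G2: "G\<^sup>2 = exp (2 * L)" using \<open>G > 0\<close> by (simp add: L_def exp_double)
    have "exp (- (2 * (d * b))) \<le> exp (2 * L) * exp (- (2 * (c * r))) + exp (- (2 * (d * L)))"
    proof (cases "b \<le> L")
      case True
      have "exp (- (2 * (d * b))) \<le> exp (2 * L - 2 * (c * r))" using True by (simp add: b)
      also have "\<dots> = exp (2 * L) * exp (- (2 * (c * r)))" by (simp flip: exp_add)
      finally show ?thesis by (simp add: add_increasing2)
    next
      case False
      then have "exp (- (2 * (d * b))) \<le> exp (- (2 * (d * L)))" using d by simp
      then show ?thesis by (simp add: add_increasing)
    qed
    then have "ennreal (exp (- (2 * (d * b))))
        \<le> ennreal (exp (2 * L) * exp (- (2 * (c * r))) + exp (- (2 * (d * L))))" by (rule ennreal_leI)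
    then show ?thesis using \<open>G > 0\<close> eq
      by (simp add: real exp_ereal_def ln_ereal_def L_def[symmetric] G2 ennreal_mult)
  next
    case MInf
    then show ?thesis using c \<open>G > 0\<close> by (simp add: exp_ereal_def ennreal_mult_top)
  qed (use v in simp)
qed

text \<open>This passes from the products of \<open>f\<close> with single generators to the product with
  \<open>|J| = \<Sum>|g|\<close>, by \<open>(a + b)\<^sup>2 \<le> 2 a\<^sup>2 + 2 b\<^sup>2\<close>.\<close>
lemma integrable_near0_sum_list_sq:
  fixes h :: "complex^'n \<Rightarrow> ennreal"
  assumes W: "open W" "0 \<in> W" and h: "h \<in> borel_measurable (restrict_space borel W)"
    and gs: "\<And>g. g \<in> set gs \<Longrightarrow> continuous_on W g"
    and int: "\<And>g. g \<in> set gs \<Longrightarrow> integrable_near0 (\<lambda>z. ennreal ((cmod (g z))\<^sup>2) * h z)"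
  shows "integrable_near0 (\<lambda>z. ennreal ((\<Sum>g\<leftarrow>gs. cmod (g z))\<^sup>2) * h z)"
  using gs int
proof (induction gs)
  case Nil
  then show ?case by (auto simp: integrable_near0_def intro!: exI[of _ UNIV])
next
  case (Cons g gs)
  have sum_cont: "continuous_on W (\<lambda>z. \<Sum>g\<leftarrow>gs. cmod (g z))"
    using Cons.prems(1) by (induction gs) (auto intro!: continuous_intros)
  have meas: "(\<lambda>z. ennreal ((a z)\<^sup>2) * h z) \<in> borel_measurable (restrict_space borel W)"
    if "continuous_on W a" for a :: "complex^'n \<Rightarrow> real"
    using borel_measurable_continuous_on_restrict[OF that] h by measurable
  have g_cont: "continuous_on W (\<lambda>z. cmod (g z))" using Cons.prems(1) by (auto intro!: continuous_intros)
  have "integrable_near0 (\<lambda>z. 2 * (ennreal ((cmod (g z))\<^sup>2) * h z) + 2 * (ennreal ((\<Sum>g\<leftarrow>gs. cmod (g z))\<^sup>2) * h z))"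
    using Cons meas[OF g_cont] meas[OF sum_cont]
    by (intro integrable_near0_add[OF W] integrable_near0_cmult[OF W]) (auto intro: borel_measurable_times)
  then show ?case
  proof (rule integrable_near0_mono[OF _ W])
    fix z
    let ?a = "cmod (g z)" and ?b = "\<Sum>g\<leftarrow>gs. cmod (g z)"
    have "(?a + ?b)\<^sup>2 \<le> 2 * ?a\<^sup>2 + 2 * ?b\<^sup>2" using sum_squares_ge_zero[of "?a - ?b" 0]
      by (simp add: power2_eq_square algebra_simps)
    then have "ennreal ((?a + ?b)\<^sup>2) * h z \<le> ennreal (2 * ?a\<^sup>2 + 2 * ?b\<^sup>2) * h z"
      by (intro mult_right_mono ennreal_leI) auto
    also have "\<dots> = 2 * (ennreal (?a\<^sup>2) * h z) + 2 * (ennreal (?b\<^sup>2) * h z)"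
      by (simp add: ennreal_mult distrib_right mult.assoc)
    finally show "ennreal ((\<Sum>g\<leftarrow>g # gs. cmod (g z))\<^sup>2) * h z
      \<le> 2 * (ennreal (?a\<^sup>2) * h z) + 2 * (ennreal (?b\<^sup>2) * h z)" by simp
  qed
qed

lemma sq_integrable_near0_interpolate:
  fixes u :: "complex^'n \<Rightarrow> ereal"
  assumes psh: "psh_on U u" "0 \<in> U" and f: "holo_near0 f" and gs: "\<And>g. g \<in> set gs \<Longrightarrow> holo_near0 g"
    and d: "0 < d" "sq_integrable_near0 f (\<lambda>z. ereal d * log_modulus gs z)"
    and c: "0 < c" "\<And>g. g \<in> set gs \<Longrightarrow> sq_integrable_near0 (\<lambda>z. f z * g z) (\<lambda>z. ereal c * u z)"
  shows "sq_integrable_near0 f (\<lambda>z. ereal (d * c / (1 + d)) * u z)"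
proof -
  obtain W0 where W0: "open W0" "0 \<in> W0" "\<And>g. g \<in> set (f # gs) \<Longrightarrow> continuous_on W0 g"
    using holo_near0_common_list[of "f # gs"] f gs by auto
  define W where "W = W0 \<inter> U"
  have W: "open W" "0 \<in> W" "W \<subseteq> U" using W0 psh by (auto simp: W_def psh_on_def)
  have cont: "continuous_on W g" if "g \<in> set (f # gs)" for g
    using continuous_on_subset[OF W0(3)[OF that]] by (auto simp: W_def)
  let ?M = "restrict_space borel W :: (complex^'n) measure"
  have [measurable]: "u \<in> borel_measurable ?M" using psh_borel_measurable[OF psh(1) W(1,3)] .
  have [measurable]: "f \<in> borel_measurable ?M"
    by (intro borel_measurable_continuous_on_restrict cont) simp
  define G where "G z = (\<Sum>g\<leftarrow>gs. cmod (g z))" for z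
  have "continuous_on W G" unfolding G_def using cont by (induction gs) (auto intro!: continuous_intros)
  then have [measurable]: "G \<in> borel_measurable ?M" by (rule borel_measurable_continuous_on_restrict)
  have "G z \<ge> 0" for z unfolding G_def by (induction gs) auto
  let ?F = "\<lambda>z. ennreal ((cmod (f z))\<^sup>2)"
  let ?h = "\<lambda>z. ?F z * exp_ereal (- (2 * (ereal c * u z)))"
  have "integrable_near0 (\<lambda>z. ennreal ((\<Sum>g\<leftarrow>gs. cmod (g z))\<^sup>2) * ?h z)"
  proof (rule integrable_near0_sum_list_sq[OF W(1,2)])
    fix g assume g: "g \<in> set gs"
    show "integrable_near0 (\<lambda>z. ennreal ((cmod (g z))\<^sup>2) * ?h z)"
      using c(2)[OF g] unfolding sq_integrable_near0_iff
      by (simp add: norm_mult power_mult_distrib ennreal_mult mult_ac)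
  qed (use cont in auto)
  then have "integrable_near0 (\<lambda>z. ennreal ((G z)\<^sup>2) * ?h z)" by (simp add: G_def)
  moreover have "integrable_near0 (\<lambda>z. ?F z * exp_ereal (- (2 * (ereal d * ln_ereal (G z)))))"
    using d(2) by (simp add: sq_integrable_near0_iff log_modulus_def G_def)
  ultimately have "integrable_near0 (\<lambda>z. ennreal ((G z)\<^sup>2) * ?h z
      + ?F z * exp_ereal (- (2 * (ereal d * ln_ereal (G z)))))"
    by (intro integrable_near0_add[OF W(1,2)]) measurable
  then show ?thesis unfolding sq_integrable_near0_iff
  proof (rule integrable_near0_mono[OF _ W(1,2)])
    fix z assume "z \<in> W"
    then have "u z < \<infinity>" using W(3) psh(1) by (auto simp: psh_on_def)
    from mult_left_mono[OF young_weights[OF \<open>G z \<ge> 0\<close> d(1) c(1) this], of "?F z"]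
    show "?F z * exp_ereal (- (2 * (ereal (d * c / (1 + d)) * u z)))
      \<le> ennreal ((G z)\<^sup>2) * ?h z + ?F z * exp_ereal (- (2 * (ereal d * ln_ereal (G z))))"
      by (simp add: distrib_left mult_ac)
  qed
qed

lemma sq_integrable_near0_of_exp_integrable:
  fixes u :: "complex^'n \<Rightarrow> ereal"
  assumes psh: "psh_on U u" "0 \<in> U" and f: "holo_near0 f" and int: "integrable_near0 (\<lambda>z. exp_ereal (- (2 * (ereal c * u z))))"
  shows "sq_integrable_near0 f (\<lambda>z. ereal c * u z)"
proof -
  obtain W0 where W0: "open W0" "0 \<in> W0" "continuous_on W0 f"
    using holo_near0_common_list[of "[f]"] f by auto
  then have "isCont f 0" by (simp add: continuous_on_eq_continuous_at)
  then have "\<forall>\<^sub>F z in nhds 0. dist (f z) (f 0) < 1"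
    by (simp add: isCont_def tendstoD tendsto_at_iff_tendsto_nhds)
  then obtain S where S: "open S" "0 \<in> S" "\<And>z. z \<in> S \<Longrightarrow> dist (f z) (f 0) < 1"
    by (auto simp: eventually_nhds)
  define B where "B = (cmod (f 0) + 1)\<^sup>2"
  have U: "open U" using psh by (simp add: psh_on_def)
  have [measurable]: "u \<in> borel_measurable (restrict_space borel U)"
    using psh_borel_measurable[OF psh(1) U] by simp
  have "integrable_near0 (\<lambda>z. ennreal B * exp_ereal (- (2 * (ereal c * u z))))"
    using int by (intro integrable_near0_cmult[OF U psh(2)]) auto
  then show ?thesis unfolding sq_integrable_near0_iff
  proof (rule integrable_near0_mono[OF _ S(1,2)])
    fix z assume "z \<in> S"
    then have "cmod (f z) \<le> cmod (f 0) + 1"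
      using S(3)[of z] norm_triangle_ineq2[of "f z" "f 0"] by (simp add: dist_norm)
    then have "(cmod (f z))\<^sup>2 \<le> B" unfolding B_def by (intro power_mono) auto
    then show "ennreal ((cmod (f z))\<^sup>2) * exp_ereal (- (2 * (ereal c * u z)))
      \<le> ennreal B * exp_ereal (- (2 * (ereal c * u z)))"
      by (intro mult_right_mono ennreal_leI) auto
  qed
qed

section \<open>Jumping numbers\<close>
lemma germ_representative:
  obtains f where "holo_near0 f" "germ f = (x :: ('n::finite) hol_germ)"
proof -
  have "germ_eq (rep_germ x) (rep_germ x)" "germ (rep_germ x) = x"
    by (rule Quotient3_rep_reflp[OF Quotient3_hol_germ], rule Quotient3_abs_rep[OF Quotient3_hol_germ])
  then show ?thesis using that by (auto simp: germ_eq_def)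
qed

lemma germ_mult:
  assumes "holo_near0 f" "holo_near0 g"
  shows "germ f * germ g = germ (\<lambda>z. f z * g z)"
  using assms by (intro times_hol_germ.abs_eq) (auto simp: germ_eq_def)

text \<open>A single exponent \<open>c\<close> for which \<open>e\<^sup>-\<^sup>2\<^sup>c\<^sup>u\<close> is integrable near \<open>0\<close> puts all germs into the
  multiplier ideal at once, since germs have bounded representatives.\<close>
lemma jumping_number_pos:
  fixes u :: "complex^'n \<Rightarrow> ereal" and I :: "('n::finite) hol_germ set"
  assumes psh: "psh_on U u" "0 \<in> U"
  shows "jumping_number I u > 0"
proof -
  obtain c where c: "c > 0" "integrable_near0 (\<lambda>z. exp_ereal (- (2 * (ereal c * u z))))"
    using psh_exp_integrable[OF psh] unfolding exp_integrable_at_def integrable_near0_def by blast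
  have "I \<subseteq> multiplier_ideal (\<lambda>z. ereal c * u z)"
  proof
    fix x assume "x \<in> I"
    obtain f where "holo_near0 f" "germ f = x" by (rule germ_representative)
    then show "x \<in> multiplier_ideal (\<lambda>z. ereal c * u z)"
      using sq_integrable_near0_of_exp_integrable[OF psh _ c(2)] by (auto simp: multiplier_ideal_def)
  qed
  then have "ereal c \<le> jumping_number I u"
    unfolding jumping_number_def using c(1) by (intro Sup_upper) auto
  then show ?thesis using c(1) by (meson ereal_less(2) order_less_le_trans)
qed

text \<open>The hypothesis on the product ideal is used for the products of a germ in \<open>I\<close> with the
  finitely many generators of \<open>J\<close>.\<close>
lemma multiplier_ideal_interpolate:
  fixes u :: "complex^'n \<Rightarrow> ereal" and I J :: "('n::finite) hol_germ set"
  assumes psh: "psh_on U u" "0 \<in> U" and gs: "generators gs J"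
    and d: "0 < d" "I \<subseteq> multiplier_ideal (\<lambda>z. ereal d * log_modulus gs z)"
    and c: "0 < c" "ideal_prod germ_ring I J \<subseteq> multiplier_ideal (\<lambda>z. ereal c * u z)"
  shows "I \<subseteq> multiplier_ideal (\<lambda>z. ereal (d * c / (1 + d)) * u z)"
proof
  fix x assume "x \<in> I"
  obtain f where f: "holo_near0 f" "germ f = x" by (rule germ_representative)
  have hg: "holo_near0 g" if "g \<in> set gs" for g using gs that by (simp add: generators_def)
  have "germ ` set gs \<subseteq> J"
    using gs ring.genideal_self[OF ring_from_type_algebra, of "germ ` set gs"]
    by (simp add: generators_def ring_of_type_algebra_def)
  have "sq_integrable_near0 (\<lambda>z. f z * g z) (\<lambda>z. ereal c * u z)" if g: "g \<in> set gs" for g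
  proof -
    have "germ f \<otimes>\<^bsub>germ_ring\<^esub> germ g \<in> ideal_prod germ_ring I J"
      using \<open>x \<in> I\<close> f(2) g \<open>germ ` set gs \<subseteq> J\<close> by (intro ideal_prod.prod) auto
    then have "germ (\<lambda>z. f z * g z) \<in> ideal_prod germ_ring I J"
      using germ_mult[OF f(1) hg[OF g]] by (simp add: ring_of_type_algebra_def)
    then show ?thesis
      using c(2) germ_in_multiplier_ideal_iff holo_near0_mult[OF f(1) hg[OF g]] by blast
  qed
  moreover have "sq_integrable_near0 f (\<lambda>z. ereal d * log_modulus gs z)"
    using d(2) \<open>x \<in> I\<close> f germ_in_multiplier_ideal_iff by blast
  ultimately have "sq_integrable_near0 f (\<lambda>z. ereal (d * c / (1 + d)) * u z)"
    using sq_integrable_near0_interpolate[OF psh f(1) hg d(1) _ c(1)] by blast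
  then show "x \<in> multiplier_ideal (\<lambda>z. ereal (d * c / (1 + d)) * u z)"
    using f germ_in_multiplier_ideal_iff by blast
qed

theorem theorem2p5:
  fixes u :: "complex^'n \<Rightarrow> ereal"
    and I J :: "('n::finite) hol_germ set"
    and U :: "(complex^'n) set"
    and gs :: "(complex^'n \<Rightarrow> complex) list"
  assumes "0 \<in> U" and "psh_on U u"
    and "ideal I germ_ring"
    and "ideal J germ_ring" and "generators gs J"
    and "J \<noteq> {0}"
    and "jumping_number I u < \<infinity>"
    and "ideal_prod germ_ring I J \<subseteq> multiplier_ideal (\<lambda>z. jumping_number I u * u z)"
  shows "jumping_number I u / (jumping_number (ideal_prod germ_ring I J) u - jumping_number I u)
           \<ge> jumping_number I (log_modulus gs)"
proof -
  define c1 where "c1 = jumping_number (ideal_prod germ_ring I J) u"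
  have pos: "jumping_number I u > 0" using jumping_number_pos assms(1,2) by blast
  then obtain r where r: "jumping_number I u = ereal r" "r > 0"
    using assms(7) by (cases "jumping_number I u") auto
  have "ideal_prod germ_ring I J \<subseteq> I"
    using ring.ideal_prod_inter[OF ring_from_type_algebra assms(3,4)] by blast
  then have "ereal r \<le> c1"
    unfolding r(1)[symmetric] c1_def jumping_number_def by (intro Sup_subset_mono) blast
  have le: "d * c \<le> r * (1 + d)"
    if d: "0 < d" "I \<subseteq> multiplier_ideal (\<lambda>z. ereal d * log_modulus gs z)"
      and c: "0 \<le> c" "ideal_prod germ_ring I J \<subseteq> multiplier_ideal (\<lambda>z. ereal c * u z)" for d c
  proof (cases "c = 0")
    case False
    then have "c > 0" using c(1) by simp
    have "I \<subseteq> multiplier_ideal (\<lambda>z. ereal (d * c / (1 + d)) * u z)"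
      using multiplier_ideal_interpolate[OF assms(2,1,5) d \<open>c > 0\<close> c(2)] .
    then have "ereal (d * c / (1 + d)) \<le> ereal r"
      unfolding r(1)[symmetric] jumping_number_def using d(1) c(1) by (intro Sup_upper) auto
    then show ?thesis using d(1) by (simp add: field_simps)
  qed (use d r in simp)
  have "jumping_number I (log_modulus gs) \<le> ereal r / (c1 - ereal r)"
    unfolding jumping_number_def[of I "log_modulus gs"]
  proof (rule Sup_least)
    fix x assume "x \<in> {ereal d |d. 0 \<le> d \<and> I \<subseteq> multiplier_ideal (\<lambda>z. ereal d * log_modulus gs z)}"
    then obtain d where d: "x = ereal d" "0 \<le> d" "I \<subseteq> multiplier_ideal (\<lambda>z. ereal d * log_modulus gs z)"
      by auto
    have "0 \<le> c1 - ereal r" using \<open>ereal r \<le> c1\<close> by (cases c1) auto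
    show "x \<le> ereal r / (c1 - ereal r)"
    proof (cases "d = 0")
      case True
      have "0 \<le> ereal r / (c1 - ereal r)"
        using r(2) \<open>0 \<le> c1 - ereal r\<close> by (intro zero_le_divide_ereal) auto
      then show ?thesis using d(1) True by (simp add: zero_ereal_def)
    next
      case False
      then have "d > 0" using d(2) by simp
      have "c1 \<le> ereal (r * (1 + d) / d)"
        unfolding c1_def jumping_number_def
      proof (rule Sup_least)
        fix y assume "y \<in> {ereal c |c. 0 \<le> c \<and> ideal_prod germ_ring I J \<subseteq> multiplier_ideal (\<lambda>z. ereal c * u z)}"
        then obtain c where c: "y = ereal c" "0 \<le> c" "ideal_prod germ_ring I J \<subseteq> multiplier_ideal (\<lambda>z. ereal c * u z)"
          by blast
        have "c \<le> r * (1 + d) / d"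
          using le[OF \<open>d > 0\<close> d(3) c(2,3)] \<open>d > 0\<close> by (simp add: pos_le_divide_eq mult.commute)
        then show "y \<le> ereal (r * (1 + d) / d)" using c(1) by simp
      qed
      then obtain s where s: "c1 = ereal s" using \<open>ereal r \<le> c1\<close> by (cases c1) auto
      have "s \<le> r * (1 + d) / d" using \<open>c1 \<le> _\<close> s by simp
      then have "s * d \<le> r * (1 + d)" using \<open>d > 0\<close> by (simp add: pos_le_divide_eq)
      then have "d * (s - r) \<le> r" by (simp add: algebra_simps)
      moreover have "r \<le> s" using \<open>ereal r \<le> c1\<close> s by simp
      ultimately have "s = r \<or> r < s \<and> d \<le> r / (s - r)" by (auto simp: pos_le_divide_eq)
      then show ?thesis using d(1) s r(2) by auto
    qed
  qed
  then show ?thesis unfolding r(1) c1_def .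
qed

end
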